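(* Let $K\ge1$, let $f=h+\overline{g}\in\mathcal{S}_H^{0}(K,\Omega)$ and let $\omega=g'/h'$. If $h$ is univalent in $\mathbb{D}$ and $$\sup_{z\in\mathbb{D}}\left\{(1-|z|^2)\left|P_f(z)+\frac{\omega'(z)\overline{\omega(z)}}{1-|\omega(z)|^2}\right|\right\}<2,$$ then $\Omega$ is a radial John disk (with respect to $f$). The constant $2$ is the best possible, i.e. the implication becomes false if $2$ is replaced by any larger constant.
   Context: $\mathbb{D}$ is the open unit disk in $\mathbb{C}$. For a domain $G\subset\mathbb{C}$ and $w\in G$, $d_G(w)$ is the Euclidean distance from $w$ to $\partial G$. $\mathcal{S}_H$ is the family of sense-preserving harmonic univalent mappings $f=h+\overline{g}$ of $\mathbb{D}$ with $h,g$ analytic in $\mathbb{D}$ and $h(0)=g(0)=h'(0)-1=0$; sense-preserving means $J_f=|h'|^2-|g'|^2>0$ in $\mathbb{D}$ (equivalently $h'\ne0$ and $|\omega|<1$ in $\mathbb{D}$, where $\omega=g'/h'$ is the dilatation). $\mathcal{S}_H^0=\{f\in\mathcal{S}_H: g'(0)=0\}$. For $K\ge1$, a sense-preserving homeomorphism $f$ of a domain, of Sobolev class $W^{1,2}_{loc}$, is $K$-quasiconformal if $\|D_f(z)\|^2\le K|\det D_f(z)|$, i.e. $\|D_f(z)\|\le K\,l(D_f(z))$, where $\|D_f\|=|f_z|+|f_{\bar z}|$ and $l(D_f)=\big||f_z|-|f_{\bar z}|\big|$. $\mathcal{S}_H^0(K,\Omega)$ is the set of $f\in\mathcal{S}_H^0$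 that are $K$-quasiconformal and map $\mathbb{D}$ onto the domain $\Omega\subset\mathbb{C}$. The Pre-Schwarzian derivative of a sense-preserving harmonic mapping $f=h+\overline{g}$ is $$P_f=(\log J_f)_z=\frac{h''\overline{h'}-g''\overline{g'}}{|h'|^2-|g'|^2}=\frac{h''}{h'}-\frac{\omega'\overline{\omega}}{1-|\omega|^2}.$$ Radial John disk: let $f$ be a complex-valued univalent mapping of $\mathbb{D}$ and let $G=f(\mathbb{D})$ be a bounded simply connected domain. $G$ is a radial $c$-John disk ($c\ge1$) if for every $z\in\mathbb{D}$ the arc $\gamma=f([0,z])$, joining $w_1=f(z)$ to the John center $w_0=f(0)$, is rectifiable and satisfies: for every $w$ on $\gamma$, the Euclidean length of the subarc $\gamma[w_1,w]$ of $\gamma$ between $w_1$ and $w$ is at most $c\,d_G(w)$. $G$ is a radial John disk if it is a radial $c$-John disk for some $c\ge1$. (An unbounded domain is not a radial John disk.) *)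

theory Defs
  imports "HOL-Complex_Analysis.Complex_Analysis"
begin

abbreviation unit_disk :: "complex set" ("\<D>") where
  "\<D> \<equiv> ball 0 1"

section \<open>Quasiconformal mappings\<close>

text \<open>The real functions on the plane that are continuously differentiable with compact support
  in \<open>U\<close>; the class of smooth test functions yields the same weak derivatives.\<close>

definition test_function :: "complex set \<Rightarrow> (complex \<Rightarrow> real) \<Rightarrow> bool" where
  "test_function U \<phi> \<longleftrightarrow>
     (\<exists>D :: complex \<Rightarrow> complex \<Rightarrow>\<^sub>L real.
        continuous_on UNIV D \<and> (\<forall>z. (\<phi> has_derivative blinfun_apply (D z)) (at z))) \<and>
     (\<exists>C. compact C \<and> C \<subseteq> U \<and> (\<forall>z. z \<notin> C \<longrightarrow> \<phi> z = 0))"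

definition loc_L2 :: "complex set \<Rightarrow> (complex \<Rightarrow> complex) \<Rightarrow> bool" where
  "loc_L2 U u \<longleftrightarrow>
     (\<forall>C. compact C \<and> C \<subseteq> U \<longrightarrow>
        set_borel_measurable lebesgue C u \<and>
        set_integrable lebesgue C (\<lambda>z. (cmod (u z))\<^sup>2))"

text \<open>\<open>p\<close> is a weak directional derivative of \<open>f\<close> in \<open>U\<close> in the direction \<open>e\<close>; the partial
  derivatives with respect to \<open>x\<close> and \<open>y\<close> belong to \<open>e = 1\<close> and \<open>e = \<i>\<close>.\<close>

definition weak_deriv ::
    "complex set \<Rightarrow> complex \<Rightarrow> (complex \<Rightarrow> complex) \<Rightarrow> (complex \<Rightarrow> complex) \<Rightarrow> bool" where
  "weak_deriv U e f p \<longleftrightarrow>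
     (\<forall>\<phi>. test_function U \<phi> \<longrightarrow>
        (LINT z:U|lebesgue. frechet_derivative \<phi> (at z) e *\<^sub>R f z) =
        - (LINT z:U|lebesgue. \<phi> z *\<^sub>R p z))"

definition W12_loc ::
    "complex set \<Rightarrow> (complex \<Rightarrow> complex) \<Rightarrow> (complex \<Rightarrow> complex) \<Rightarrow> (complex \<Rightarrow> complex) \<Rightarrow> bool" where
  "W12_loc U f fx fy \<longleftrightarrow>
     loc_L2 U f \<and> loc_L2 U fx \<and> loc_L2 U fy \<and> weak_deriv U 1 f fx \<and> weak_deriv U \<i> f fy"

text \<open>A planar homeomorphism preserves the sense iff it maps each positively oriented circle
  around \<open>z\<close> to a curve winding once, in the positive sense, around the image of \<open>z\<close>.\<close>

definition sense_preserving_on :: "complex set \<Rightarrow> (complex \<Rightarrow> complex) \<Rightarrow> bool" where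
  "sense_preserving_on U f \<longleftrightarrow>
     (\<forall>z r. 0 < r \<and> cball z r \<subseteq> U \<longrightarrow> winding_number (f \<circ> circlepath z r) (f z) = 1)"

text \<open>In the inequality, \<open>fz\<close> and \<open>fzb\<close> are the derivatives of \<open>f\<close> with respect to \<open>z\<close> and its
  conjugate: \<open>cmod fz + cmod fzb\<close> is the operator norm of the real differential of \<open>f\<close>, and
  the difference of the squares is its determinant.\<close>

definition quasiconformal_on :: "real \<Rightarrow> complex set \<Rightarrow> (complex \<Rightarrow> complex) \<Rightarrow> bool" where
  "quasiconformal_on K U f \<longleftrightarrow>
     1 \<le> K \<and> open U \<and> connected U \<and> U \<noteq> {} \<and>
     (\<exists>k. homeomorphism U (f ` U) f k) \<and> sense_preserving_on U f \<and>
     (\<exists>fx fy. W12_loc U f fx fy \<and>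
        (AE z in lebesgue. z \<in> U \<longrightarrow>
           (let fz = (fx z - \<i> * fy z) / 2; fzb = (fx z + \<i> * fy z) / 2
            in (cmod fz + cmod fzb)\<^sup>2 \<le> K * \<bar>(cmod fz)\<^sup>2 - (cmod fzb)\<^sup>2\<bar>)))"

section \<open>Harmonic mappings\<close>

definition harmonic_decomp ::
    "(complex \<Rightarrow> complex) \<Rightarrow> (complex \<Rightarrow> complex) \<Rightarrow> (complex \<Rightarrow> complex) \<Rightarrow> bool" where
  "harmonic_decomp f h g \<longleftrightarrow>
     h holomorphic_on \<D> \<and> g holomorphic_on \<D> \<and> h 0 = 0 \<and> g 0 = 0 \<and>
     (\<forall>z\<in>\<D>. f z = h z + cnj (g z))"

definition jacobian ::
    "(complex \<Rightarrow> complex) \<Rightarrow> (complex \<Rightarrow> complex) \<Rightarrow> complex \<Rightarrow> real" where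
  "jacobian h g z = (cmod (deriv h z))\<^sup>2 - (cmod (deriv g z))\<^sup>2"

definition dilatation ::
    "(complex \<Rightarrow> complex) \<Rightarrow> (complex \<Rightarrow> complex) \<Rightarrow> complex \<Rightarrow> complex" where
  "dilatation h g z = deriv g z / deriv h z"

definition S_H :: "(complex \<Rightarrow> complex) set" where
  "S_H = {f. inj_on f \<D> \<and>
     (\<exists>h g. harmonic_decomp f h g \<and> deriv h 0 = 1 \<and> (\<forall>z\<in>\<D>. jacobian h g z > 0))}"

definition S_H0 :: "(complex \<Rightarrow> complex) set" where
  "S_H0 = {f \<in> S_H. \<exists>h g. harmonic_decomp f h g \<and> deriv g 0 = 0}"

definition S_H0_qc :: "real \<Rightarrow> complex set \<Rightarrow> (complex \<Rightarrow> complex) set" where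
  "S_H0_qc K \<Omega> = {f \<in> S_H0. quasiconformal_on K \<D> f \<and> f ` \<D> = \<Omega>}"

definition wirtinger_deriv :: "(complex \<Rightarrow> complex) \<Rightarrow> complex \<Rightarrow> complex" where
  "wirtinger_deriv F z =
     (frechet_derivative F (at z) 1 - \<i> * frechet_derivative F (at z) \<i>) / 2"

definition pre_schwarzian ::
    "(complex \<Rightarrow> complex) \<Rightarrow> (complex \<Rightarrow> complex) \<Rightarrow> complex \<Rightarrow> complex" where
  "pre_schwarzian h g = wirtinger_deriv (\<lambda>z. complex_of_real (ln (jacobian h g z)))"

section \<open>Radial John disks\<close>

definition curve_length :: "(real \<Rightarrow> complex) \<Rightarrow> real \<Rightarrow> real \<Rightarrow> ereal" where
  "curve_length \<gamma> a b =
     (SUP (n, t) \<in> {(n :: nat, t). mono_on {..n} t \<and> t ` {..n} \<subseteq> {a..b}}.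
        ereal (\<Sum>i<n. dist (\<gamma> (t i)) (\<gamma> (t (Suc i)))))"

text \<open>The arc \<open>f([0,z])\<close> is parametrised by \<open>\<lambda>t. f (t * z)\<close> on \<open>[0,1]\<close>, so its subarc between
  \<open>f z\<close> and \<open>w = f (s * z)\<close> is the part over \<open>[s,1]\<close>.\<close>

definition radial_John_disk_const ::
    "real \<Rightarrow> (complex \<Rightarrow> complex) \<Rightarrow> complex set \<Rightarrow> bool" where
  "radial_John_disk_const c f G \<longleftrightarrow>
     1 \<le> c \<and> continuous_on \<D> f \<and> inj_on f \<D> \<and> f ` \<D> = G \<and>
     open G \<and> bounded G \<and> simply_connected G \<and>
     (\<forall>z\<in>\<D>. curve_length (\<lambda>t. f (of_real t * z)) 0 1 < \<infinity> \<and>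
        (\<forall>s\<in>{0..1}. curve_length (\<lambda>t. f (of_real t * z)) s 1
                       \<le> ereal (c * infdist (f (of_real s * z)) (frontier G))))"

definition radial_John_disk :: "(complex \<Rightarrow> complex) \<Rightarrow> complex set \<Rightarrow> bool" where
  "radial_John_disk f G \<longleftrightarrow> (\<exists>c. radial_John_disk_const c f G)"

end

theory Submission
  imports Defs
begin

text \<open>Adding \<open>\<omega>' cnj \<omega>/(1 - \<bar>\<omega>\<bar>\<^sup>2)\<close> to the Pre-Schwarzian derivative cancels the influence of the dilatation and
  leaves \<open>h''/h'\<close>. So the hypothesis says that, for some \<open>p < 1\<close>, the logarithm of \<open>h'\<close> has a derivative of
  modulus at most \<open>2p/(1 - \<bar>z\<bar>\<^sup>2)\<close>. This bound is used at two scales.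

  Integrated along a radius it shows that \<open>\<bar>h'\<bar>\<close> grows at most like \<open>(1 - x) powr (- p)\<close>. As \<open>p < 1\<close> and
  \<open>\<bar>g'\<bar> \<le> \<bar>h'\<bar>\<close>, the image of the radial segment beyond \<open>w\<close> has length at most a constant times
  \<open>\<bar>h' w\<bar> (1 - \<bar>w\<bar>)\<close> (lemma \<open>radial_arc_bound\<close>); in particular the image is bounded.

  On a disk around \<open>w\<close> of radius a small multiple of \<open>1 - \<bar>w\<bar>\<close> it shows that \<open>h'\<close> is nearly constant.
  Quasiconformality gives \<open>\<bar>g'\<bar> \<le> k \<bar>h'\<bar>\<close> with \<open>k < 1\<close>, so on this disk \<open>f\<close> moves points away from \<open>f w\<close> by at
  least a multiple of \<open>\<bar>h' w\<bar>\<close> times their distance from \<open>w\<close>. As \<open>f\<close> is an open map, the distance from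
  \<open>f w\<close> to the boundary of the image is at least a constant times \<open>\<bar>h' w\<bar> (1 - \<bar>w\<bar>)\<close>
  (lemma \<open>image_contains_ball\<close>). The two estimates together are the radial John condition.

  Quasiconformality is expressed through weak derivatives. To bound \<open>\<bar>g'\<bar>\<close> by \<open>k \<bar>h'\<bar>\<close> pointwise they have to be
  identified with the classical ones, which takes two facts: classical derivatives are weak derivatives
  (lemma \<open>weak_deriv_classical\<close>, from translation invariance of Lebesgue measure), and weak derivatives are
  unique almost everywhere (lemma \<open>weak_deriv_unique\<close>).

  The constant \<open>2\<close> is sharp because of the univalent map \<open>- log (1 - z)\<close>. It has \<open>h''/h' = 1/(1 - z)\<close>,
  so its supremum is \<open>2\<close>, but it is unbounded.\<close>

section \<open>Continuously differentiable bump functions\<close>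

text \<open>The regularity clause of \<^const>\<open>test_function\<close>, separated from the condition on the support so
  that it can be checked compositionally.\<close>

definition cont_diff :: "(complex \<Rightarrow> real) \<Rightarrow> bool" where
  "cont_diff \<phi> \<longleftrightarrow> (\<exists>D :: complex \<Rightarrow> complex \<Rightarrow>\<^sub>L real. continuous_on UNIV D \<and>
     (\<forall>z. (\<phi> has_derivative blinfun_apply (D z)) (at z)))"

lemma cont_diff_linear:
  assumes "bounded_linear f" shows "cont_diff f"
  unfolding cont_diff_def
  by (rule exI[of _ "\<lambda>_. Blinfun f"])
     (auto simp: bounded_linear_Blinfun_apply assms bounded_linear_imp_has_derivative)

lemma cont_diff_compose:
  assumes "cont_diff \<phi>" and "\<And>t. (q has_real_derivative q' t) (at t)" and "continuous_on UNIV q'"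
  shows "cont_diff (\<lambda>z. q (\<phi> z))"
proof -
  obtain D where D: "continuous_on UNIV D" "\<And>z. (\<phi> has_derivative blinfun_apply (D z)) (at z)"
    using assms(1) unfolding cont_diff_def by auto
  have "continuous_on UNIV \<phi>"
    by (meson D(2) has_derivative_continuous continuous_at_imp_continuous_on)
  then have "continuous_on UNIV (\<lambda>z. q' (\<phi> z) *\<^sub>R D z)"
    by (intro continuous_on_scaleR D(1) continuous_on_compose2[OF assms(3)]) auto
  moreover have "((\<lambda>z. q (\<phi> z)) has_derivative blinfun_apply (q' (\<phi> z) *\<^sub>R D z)) (at z)" for z
  proof -
    have "(q has_derivative (\<lambda>h. h * q' (\<phi> z))) (at (\<phi> z))"
      using assms(2)[of "\<phi> z"] by (simp add: has_field_derivative_def mult_commute_abs)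
    from has_derivative_compose[OF D(2)[of z] this]
    show ?thesis by (simp add: scaleR_blinfun.rep_eq mult.commute)
  qed
  ultimately show ?thesis unfolding cont_diff_def
    by (intro exI[of _ "\<lambda>z. q' (\<phi> z) *\<^sub>R D z"]) auto
qed

lemma cont_diff_mult:
  assumes "cont_diff \<phi>" "cont_diff \<psi>" shows "cont_diff (\<lambda>z. \<phi> z * \<psi> z)"
proof -
  obtain D where D: "continuous_on UNIV D" "\<And>z. (\<phi> has_derivative blinfun_apply (D z)) (at z)"
    using assms(1) unfolding cont_diff_def by auto
  obtain E where E: "continuous_on UNIV E" "\<And>z. (\<psi> has_derivative blinfun_apply (E z)) (at z)"
    using assms(2) unfolding cont_diff_def by auto
  have "continuous_on UNIV \<phi>" "continuous_on UNIV \<psi>"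
    by (meson D(2) E(2) has_derivative_continuous continuous_at_imp_continuous_on)+
  then have "continuous_on UNIV (\<lambda>z. \<phi> z *\<^sub>R E z + \<psi> z *\<^sub>R D z)"
    by (intro continuous_on_add continuous_on_scaleR D(1) E(1))
  moreover have "((\<lambda>z. \<phi> z * \<psi> z) has_derivative blinfun_apply (\<phi> z *\<^sub>R E z + \<psi> z *\<^sub>R D z)) (at z)" for z
    using has_derivative_mult[OF D(2)[of z] E(2)[of z]]
    by (simp add: scaleR_blinfun.rep_eq plus_blinfun.rep_eq mult.commute)
  ultimately show ?thesis unfolding cont_diff_def
    by (intro exI[of _ "\<lambda>z. \<phi> z *\<^sub>R E z + \<psi> z *\<^sub>R D z"]) auto
qed

text \<open>The square of the positive part is the simplest function of class \<open>C\<^sup>1\<close> that vanishes on a half-line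
  without vanishing identically; composed with quadratic polynomials it gives bumps on intervals.\<close>

lemma has_derivative_square_pos_part:
  "((\<lambda>t::real. (max 0 t)\<^sup>2) has_real_derivative 2 * max 0 t) (at t)"
proof -
  consider "t < 0" | "t > 0" | "t = 0" by linarith
  then show ?thesis
  proof cases
    case 1
    have "((\<lambda>t. 0) has_real_derivative 0) (at t)" by simp
    then have "((\<lambda>t::real. (max 0 t)\<^sup>2) has_real_derivative 0) (at t)"
      by (rule has_field_derivative_transform_within_open[where S="{..<0}"]) (use 1 in auto)
    then show ?thesis using 1 by simp
  next
    case 2
    have "((\<lambda>t::real. t\<^sup>2) has_real_derivative 2 * t) (at t)"
      by (auto intro!: derivative_eq_intros)
    then have "((\<lambda>t::real. (max 0 t)\<^sup>2) has_real_derivative 2 * t) (at t)"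
      by (rule has_field_derivative_transform_within_open[where S="{0<..}"]) (use 2 in auto)
    then show ?thesis using 2 by simp
  next
    case 3
    have "((\<lambda>h::real. (max 0 h)\<^sup>2 / h) \<longlongrightarrow> 0) (at 0)"
    proof (rule Lim_null_comparison)
      show "\<forall>\<^sub>F h in at 0. norm ((max 0 h)\<^sup>2 / h) \<le> \<bar>h::real\<bar>"
        by (auto simp: max_def power2_eq_square)
      show "((\<lambda>h. \<bar>h\<bar>) \<longlongrightarrow> (0::real)) (at 0)"
        using tendsto_rabs_zero[OF tendsto_ident_at] by auto
    qed
    then show ?thesis using 3 by (simp add: DERIV_def)
  qed
qed

text \<open>A product of two one-dimensional bumps gives a function \<open>\<beta>\<close> that is positive exactly on the box;
  \<open>1 - exp (- n * \<beta>)\<close> then increases to the indicator function of the box.\<close>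

lemma box_bump_sequence:
  fixes a b :: complex
  assumes ne: "box a b \<noteq> {}"
  obtains \<phi> :: "nat \<Rightarrow> complex \<Rightarrow> real" where
    "\<And>n. cont_diff (\<phi> n)" "\<And>n z. 0 \<le> \<phi> n z" "\<And>n z. \<phi> n z \<le> 1"
    "\<And>n z. z \<notin> box a b \<Longrightarrow> \<phi> n z = 0"
    "\<And>z. z \<in> box a b \<Longrightarrow> (\<lambda>n. \<phi> n z) \<longlonglongrightarrow> 1"
proof -
  have ab: "Re a < Re b" "Im a < Im b"
    using ne by (auto simp: box_ne_empty Basis_complex_def)
  define p where "p = (\<lambda>t::real. (max 0 t)\<^sup>2)"
  \<comment> \<open>The quadratic polynomials are positive exactly between the endpoints of the two sides.\<close>
  define \<beta> where "\<beta> = (\<lambda>z. p ((Re z - Re a) * (Re b - Re z)) * p ((Im z - Im a) * (Im b - Im z)))"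
  define \<phi> where "\<phi> = (\<lambda>(n::nat) z. 1 - exp (- real n * \<beta> z))"
  have p: "(p has_real_derivative 2 * max 0 t) (at t)" for t
    unfolding p_def by (rule has_derivative_square_pos_part)
  have Re: "cont_diff (\<lambda>z. (Re z - Re a) * (Re b - Re z))"
    by (rule cont_diff_compose[where \<phi>=Re and q="\<lambda>t. (t - Re a) * (Re b - t)" and q'="\<lambda>t. (Re b - t) - (t - Re a)"])
       (auto intro!: cont_diff_linear bounded_linear_Re derivative_eq_intros continuous_intros)
  have Im: "cont_diff (\<lambda>z. (Im z - Im a) * (Im b - Im z))"
    by (rule cont_diff_compose[where \<phi>=Im and q="\<lambda>t. (t - Im a) * (Im b - t)" and q'="\<lambda>t. (Im b - t) - (t - Im a)"])
       (auto intro!: cont_diff_linear bounded_linear_Im derivative_eq_intros continuous_intros)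
  have \<beta>: "cont_diff \<beta>" unfolding \<beta>_def
    by (intro cont_diff_mult cont_diff_compose[where q=p, OF Re p] cont_diff_compose[where q=p, OF Im p] continuous_intros)
  have \<beta>0: "\<beta> z \<ge> 0" for z by (auto simp: \<beta>_def p_def)
  have pos: "\<beta> z > 0" if "z \<in> box a b" for z
    using that by (auto simp: \<beta>_def p_def in_box_complex_iff max_def not_le intro!: mult_pos_pos)
  have zero: "\<beta> z = 0" if "z \<notin> box a b" for z
  proof -
    have aux: "p ((x - c) * (d - x)) = 0" if "c < d" "\<not> (c < x \<and> x < d)" for c d x :: real
    proof -
      have "(x - c) * (d - x) \<le> 0" unfolding mult_le_0_iff using that by linarith
      then show ?thesis by (simp add: p_def max_def)
    qed
    have "\<not> (Re a < Re z \<and> Re z < Re b) \<or> \<not> (Im a < Im z \<and> Im z < Im b)"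
      using that by (auto simp: in_box_complex_iff)
    with aux ab show ?thesis by (auto simp: \<beta>_def)
  qed
  show ?thesis
  proof (rule that[of \<phi>])
    show "cont_diff (\<phi> n)" for n unfolding \<phi>_def
      by (rule cont_diff_compose[OF \<beta>, where q="\<lambda>t. 1 - exp (- real n * t)" and q'="\<lambda>t. real n * exp (- real n * t)"])
         (auto intro!: derivative_eq_intros continuous_intros)
    show "0 \<le> \<phi> n z" for n z using \<beta>0[of z] by (simp add: \<phi>_def)
    show "\<phi> n z \<le> 1" for n z by (simp add: \<phi>_def)
    show "\<phi> n z = 0" if "z \<notin> box a b" for n z using zero[OF that] by (simp add: \<phi>_def)
    show "(\<lambda>n. \<phi> n z) \<longlonglongrightarrow> 1" if "z \<in> box a b" for z
    proof -
      have "exp (- \<beta> z) < 1" using pos[OF that] by simp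
      then have "(\<lambda>n. exp (- \<beta> z) ^ n) \<longlonglongrightarrow> 0"
        using LIMSEQ_power_zero[of "exp (- \<beta> z)"] by simp
      then have "(\<lambda>n. 1 - exp (- \<beta> z) ^ n) \<longlonglongrightarrow> 1 - 0" by (intro tendsto_diff tendsto_const)
      then show ?thesis by (simp add: \<phi>_def exp_of_nat_mult[symmetric])
    qed
  qed
qed

section \<open>Uniqueness of weak derivatives\<close>


lemma sigma_finite_lebesgue: "sigma_finite_measure (lebesgue :: 'a::euclidean_space measure)"
proof -
  obtain A :: "'a set set" where A: "countable A \<and> A \<subseteq> sets lborel \<and> \<Union>A = space lborel \<and>
      (\<forall>a\<in>A. emeasure lborel a \<noteq> \<infinity>)"
    using lborel.sigma_finite_countable ..
  then have "a \<in> sets lborel" if "a \<in> A" for a using that by blast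
  with A have "countable A \<and> A \<subseteq> sets lebesgue \<and> \<Union>A = space lebesgue \<and>
      (\<forall>a\<in>A. emeasure lebesgue a \<noteq> \<infinity>)"
    by (auto intro: sets_completionI_sets)
  then show ?thesis unfolding sigma_finite_measure_def by blast
qed

text \<open>Boxes are stable under intersection and generate the Borel sets, so by Dynkin's lemma all Borel sets,
  and hence all Lebesgue sets, inherit the vanishing of the integral.\<close>

lemma AE_zero_if_integral_box_zero:
  fixes v :: "'a::euclidean_space \<Rightarrow> 'b::{banach, second_countable_topology}"
  assumes int: "integrable lebesgue v"
    and box: "\<And>a b. set_lebesgue_integral lebesgue (box a b) v = 0"
  shows "AE x in lebesgue. v x = 0"
proof (rule sigma_finite_measure.density_zero[OF sigma_finite_lebesgue int])
  have sint: "set_integrable lebesgue A v" if "A \<in> sets lebesgue" for A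
    unfolding set_integrable_def using int that by (intro integrable_mult_indicator)
  have UNIV: "set_lebesgue_integral lebesgue UNIV v = 0"
  proof -
    let ?B = "\<lambda>n::nat. box (- (real n *\<^sub>R One)) (real n *\<^sub>R One) :: 'a set"
    have "(\<lambda>n. set_lebesgue_integral lebesgue (?B n) v) \<longlonglongrightarrow> set_lebesgue_integral lebesgue (\<Union>n. ?B n) v"
    proof (rule set_integral_cont_up)
      show "incseq ?B"
      proof (rule incseq_SucI)
        show "?B n \<subseteq> ?B (Suc n)" for n
          unfolding box_def by (fastforce simp: inner_Basis)
      qed
    qed (auto intro: sint)
    then show ?thesis by (simp add: box UN_box_eq_UNIV LIMSEQ_const_iff)
  qed
  have borel: "set_lebesgue_integral lebesgue A v = 0" if A: "A \<in> sets borel" for A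
  proof -
    let ?E = "range (\<lambda>(a, b). box a b :: 'a set)"
    have "Int_stable ?E" by (auto simp: Int_stable_def box_Int_box)
    moreover have "?E \<subseteq> Pow UNIV" by auto
    moreover have "A \<in> sigma_sets UNIV ?E" using A by (simp add: borel_eq_box)
    ultimately show ?thesis
    proof (induction rule: sigma_sets_induct_disjoint)
      case (basic A) then show ?case using box by auto
    next
      case empty then show ?case by (simp add: set_lebesgue_integral_def)
    next
      case (compl A)
      then have [measurable]: "A \<in> sets lebesgue" by (auto simp: borel_eq_box)
      have "set_lebesgue_integral lebesgue (A \<union> (UNIV - A)) v =
        set_lebesgue_integral lebesgue A v + set_lebesgue_integral lebesgue (UNIV - A) v"
        by (intro set_integral_Un sint) auto
      with compl UNIV show ?case by simp
    next
      case (union F)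
      then have [measurable]: "F i \<in> sets lebesgue" for i by (auto simp: borel_eq_box image_subset_iff)
      have "set_lebesgue_integral lebesgue (\<Union>i. F i) v = (\<Sum>i. set_lebesgue_integral lebesgue (F i) v)"
        using union.hyps(1) by (intro lebesgue_integral_countable_add sint) (auto simp: disjoint_family_on_def)
      with union show ?case by simp
    qed
  qed
  fix A :: "'a set" assume "A \<in> sets lebesgue"
  then obtain S N N' where A: "A = S \<union> N" "N \<subseteq> N'" "N' \<in> null_sets lborel" "S \<in> sets lborel"
    by (rule sets_completionE)
  have "AE x in lebesgue. x \<notin> N'"
    using A(3) by (intro AE_not_in) (auto simp: null_sets_completionI)
  then have "set_lebesgue_integral lebesgue A v = set_lebesgue_integral lebesgue S v"
    unfolding set_lebesgue_integral_def
    using \<open>A \<in> sets lebesgue\<close> A(4) int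
    by (intro integral_cong_AE borel_measurable_scaleR borel_measurable_indicator)
       (use A in \<open>auto elim!: eventually_mono split: split_indicator\<close>)
  with borel A show "set_lebesgue_integral lebesgue A v = 0" by simp
qed

lemma test_function_iff:
  "test_function U \<phi> \<longleftrightarrow> cont_diff \<phi> \<and> (\<exists>C. compact C \<and> C \<subseteq> U \<and> (\<forall>z. z \<notin> C \<longrightarrow> \<phi> z = 0))"
  unfolding test_function_def cont_diff_def ..

lemma cont_diff_continuous: "cont_diff \<phi> \<Longrightarrow> continuous_on UNIV \<phi>"
  unfolding cont_diff_def by (meson has_derivative_continuous continuous_at_imp_continuous_on)

lemma integrable_test_mult:
  fixes u :: "complex \<Rightarrow> complex" and \<phi> :: "complex \<Rightarrow> real"
  assumes C: "compact C" "\<And>z. z \<notin> C \<Longrightarrow> \<phi> z = 0" and \<phi>: "continuous_on UNIV \<phi>"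
    and u: "set_integrable lebesgue C u"
  shows "integrable lebesgue (\<lambda>z. \<phi> z *\<^sub>R u z)"
proof -
  have "bounded (\<phi> ` C)"
    by (intro compact_imp_bounded compact_continuous_image continuous_on_subset[OF \<phi>] C) auto
  then obtain B where B: "\<And>z. z \<in> C \<Longrightarrow> \<bar>\<phi> z\<bar> \<le> B" unfolding bounded_iff by auto
  have \<phi>m: "\<phi> \<in> borel_measurable lebesgue"
    using borel_measurable_continuous_onI[OF \<phi>] by (auto intro: measurable_completion)
  have um: "(\<lambda>z. indicator C z *\<^sub>R u z) \<in> borel_measurable lebesgue"
    using u unfolding set_integrable_def by (rule borel_measurable_integrable)
  have eq: "\<phi> z *\<^sub>R u z = \<phi> z *\<^sub>R (indicator C z *\<^sub>R u z)" for z
    using C(2)[of z] by (auto simp: indicator_def)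
  show ?thesis
  proof (rule Bochner_Integration.integrable_bound)
    show "integrable lebesgue (\<lambda>z. B *\<^sub>R (indicator C z *\<^sub>R u z))"
      using u unfolding set_integrable_def by (intro integrable_scaleR_right)
    show "(\<lambda>z. \<phi> z *\<^sub>R u z) \<in> borel_measurable lebesgue"
      unfolding eq by (intro borel_measurable_scaleR \<phi>m um)
    show "AE z in lebesgue. norm (\<phi> z *\<^sub>R u z) \<le> norm (B *\<^sub>R (indicator C z *\<^sub>R u z))"
    proof (rule AE_I2)
      fix z
      show "norm (\<phi> z *\<^sub>R u z) \<le> norm (B *\<^sub>R (indicator C z *\<^sub>R u z))"
        using C(2)[of z] B[of z] by (cases "z \<in> C") (auto intro!: mult_right_mono order_trans[OF B])
    qed
  qed
qed

text \<open>The fundamental lemma of the calculus of variations: bumps converging to the indicator function of a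
  box transfer the hypothesis from test functions to boxes by dominated convergence.\<close>

lemma AE_zero_if_test_integrals_zero:
  fixes u :: "complex \<Rightarrow> complex"
  assumes U: "open U" and loc: "\<And>C. compact C \<Longrightarrow> C \<subseteq> U \<Longrightarrow> set_integrable lebesgue C u"
    and zero: "\<And>\<phi>. test_function U \<phi> \<Longrightarrow> (LINT z|lebesgue. \<phi> z *\<^sub>R u z) = 0"
  shows "AE z in lebesgue. z \<in> U \<longrightarrow> u z = 0"
proof -
  have box: "set_lebesgue_integral lebesgue (box a b) u = 0" if sub: "cbox a b \<subseteq> U" for a b
  proof (cases "box a b = {}")
    case False
    then obtain \<phi> where \<phi>: "\<And>n. cont_diff (\<phi> n)" "\<And>n z. 0 \<le> \<phi> n z" "\<And>n z. \<phi> n z \<le> 1"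
      "\<And>n z. z \<notin> box a b \<Longrightarrow> \<phi> n z = 0" "\<And>z. z \<in> box a b \<Longrightarrow> (\<lambda>n. \<phi> n z) \<longlonglongrightarrow> 1"
      using box_bump_sequence[OF False] by metis
    have out: "\<phi> n z = 0" if "z \<notin> cbox a b" for n z
      using that box_subset_cbox by (intro \<phi>(4)) blast
    have int: "set_integrable lebesgue (cbox a b) u" using loc sub by simp
    have "(\<lambda>n. LINT z|lebesgue. \<phi> n z *\<^sub>R u z) \<longlonglongrightarrow> (LINT z|lebesgue. indicator (box a b) z *\<^sub>R u z)"
    proof (rule integral_dominated_convergence[where w="\<lambda>z. norm (indicator (cbox a b) z *\<^sub>R u z)"])
      have "set_integrable lebesgue (box a b) u"
        by (rule set_integrable_subset[OF int]) (auto simp: box_subset_cbox)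
      then show "(\<lambda>z. indicator (box a b) z *\<^sub>R u z) \<in> borel_measurable lebesgue"
        unfolding set_integrable_def by (rule borel_measurable_integrable)
      show "(\<lambda>z. \<phi> n z *\<^sub>R u z) \<in> borel_measurable lebesgue" for n
        by (rule borel_measurable_integrable, rule integrable_test_mult[OF compact_cbox out _ int])
           (auto intro: cont_diff_continuous \<phi>)
      show "integrable lebesgue (\<lambda>z. norm (indicator (cbox a b) z *\<^sub>R u z))"
        using int unfolding set_integrable_def by (rule integrable_norm)
      show "AE z in lebesgue. (\<lambda>n. \<phi> n z *\<^sub>R u z) \<longlonglongrightarrow> indicator (box a b) z *\<^sub>R u z"
      proof (rule AE_I2)
        fix z show "(\<lambda>n. \<phi> n z *\<^sub>R u z) \<longlonglongrightarrow> indicator (box a b) z *\<^sub>R u z"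
        proof (cases "z \<in> box a b")
          case True
          then show ?thesis using tendsto_scaleR[OF \<phi>(5)[OF True] tendsto_const[of "u z"]] by simp
        qed (simp add: \<phi>)
      qed
      show "AE z in lebesgue. norm (\<phi> n z *\<^sub>R u z) \<le> norm (indicator (cbox a b) z *\<^sub>R u z)" for n
      proof (rule AE_I2)
        fix z show "norm (\<phi> n z *\<^sub>R u z) \<le> norm (indicator (cbox a b) z *\<^sub>R u z)"
          using out[of z n] \<phi>(2,3)[of n z]
          by (cases "z \<in> cbox a b") (auto simp: mult_left_le_one_le)
      qed
    qed
    moreover have "(LINT z|lebesgue. \<phi> n z *\<^sub>R u z) = 0" for n
      using \<phi>(1) out sub by (intro zero) (auto simp: test_function_iff intro!: exI[of _ "cbox a b"])
    ultimately show ?thesis by (simp add: set_lebesgue_integral_def LIMSEQ_const_iff)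
  qed (simp add: set_lebesgue_integral_def)
  have cbox: "AE z in lebesgue. z \<in> cbox a b \<longrightarrow> u z = 0" if sub: "cbox a b \<subseteq> U" for a b
  proof -
    let ?v = "\<lambda>z. indicator (box a b) z *\<^sub>R u z"
    have "AE z in lebesgue. ?v z = 0"
    proof (rule AE_zero_if_integral_box_zero)
      have "set_integrable lebesgue (box a b) u"
        by (rule set_integrable_subset[OF loc[OF compact_cbox sub]]) (auto simp: box_subset_cbox)
      then show "integrable lebesgue ?v" by (simp add: set_integrable_def)
      fix c d :: complex
      obtain a' b' where Int: "box c d \<inter> box a b = box a' b'"
        using box_Int_box[of c d a b] by (rule that)
      have "set_lebesgue_integral lebesgue (box c d) ?v = set_lebesgue_integral lebesgue (box a' b') u"
        unfolding set_lebesgue_integral_def Int[symmetric] by (simp add: indicator_inter_arith)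
      also have "\<dots> = 0"
      proof (cases "box a' b' = {}")
        case False
        then have "cbox a' b' = closure (box a' b')" by simp
        also have "\<dots> \<subseteq> closure (box a b)" unfolding Int[symmetric] by (intro closure_mono) auto
        also have "\<dots> \<subseteq> U" using sub by (metis box_subset_cbox closure_minimal closed_cbox order_trans)
        finally show ?thesis by (rule box)
      qed (simp add: set_lebesgue_integral_def)
      finally show "set_lebesgue_integral lebesgue (box c d) ?v = 0" .
    qed
    moreover have "AE z in lebesgue. z \<notin> frontier (cbox a b)"
      by (intro AE_not_in) (simp add: negligible_iff_null_sets[symmetric] negligible_frontier_interval frontier_cbox)
    ultimately show ?thesis
    proof eventually_elim
      case (elim z)
      then show ?case by (cases "z \<in> box a b") (auto simp: frontier_cbox)
    qed
  qed
  obtain \<B> where \<B>: "countable \<B>" "\<B> \<subseteq> Pow U" "\<And>X. X \<in> \<B> \<Longrightarrow> \<exists>a b. X = cbox a b" "\<Union>\<B> = U"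
    using open_countable_Union_open_cbox[OF U] by metis
  have "AE z in lebesgue. \<forall>X\<in>\<B>. z \<in> X \<longrightarrow> u z = 0"
  proof (subst AE_ball_countable[OF \<B>(1)], intro ballI)
    fix X assume X: "X \<in> \<B>"
    then obtain a b where "X = cbox a b" using \<B>(3) by blast
    with X \<B>(2) cbox show "AE z in lebesgue. z \<in> X \<longrightarrow> u z = 0" by auto
  qed
  then show ?thesis using \<B>(4) by (auto elim!: eventually_mono)
qed

text \<open>On sets of finite measure the estimate \<open>t \<le> t\<^sup>2 + 1\<close> bounds the \<open>L\<^sup>1\<close> norm by the \<open>L\<^sup>2\<close> norm.\<close>

lemma loc_L2_set_integrable:
  assumes "loc_L2 U p" "compact C" "C \<subseteq> U"
  shows "set_integrable lebesgue C p"
proof -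
  have 1: "(\<lambda>z. indicator C z *\<^sub>R p z) \<in> borel_measurable lebesgue"
    and 2: "integrable lebesgue (\<lambda>z. indicator C z *\<^sub>R (cmod (p z))\<^sup>2)"
    using assms unfolding loc_L2_def set_borel_measurable_def set_integrable_def by auto
  have "emeasure lebesgue C < \<infinity>"
    using emeasure_compact_finite[OF assms(2)] assms(2) by (simp add: borel_compact)
  then have 3: "integrable lebesgue (\<lambda>z. indicator C z :: real)"
    using assms(2) by (intro integrable_real_indicator) (auto simp: compact_imp_closed)
  show ?thesis unfolding set_integrable_def
  proof (rule Bochner_Integration.integrable_bound[OF Bochner_Integration.integrable_add[OF 2 3] 1])
    have "t \<le> t\<^sup>2 + 1" for t :: real
      using zero_le_power2[of "t - 1/2"] by (simp add: power2_eq_square algebra_simps)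
    then show "AE z in lebesgue. norm (indicator C z *\<^sub>R p z)
        \<le> norm (indicator C z *\<^sub>R (cmod (p z))\<^sup>2 + (indicator C z :: real))"
      by (intro AE_I2) (auto split: split_indicator)
  qed
qed

text \<open>This is what turns the almost-everywhere inequality for the unspecified weak derivatives in
  \<^const>\<open>quasiconformal_on\<close> into an inequality for the classical derivatives of a smooth map.\<close>

lemma weak_deriv_unique:
  assumes "open U" "loc_L2 U p" "loc_L2 U q" "weak_deriv U e f p" "weak_deriv U e f q"
  shows "AE z in lebesgue. z \<in> U \<longrightarrow> p z = q z"
proof -
  have "AE z in lebesgue. z \<in> U \<longrightarrow> p z - q z = 0"
  proof (rule AE_zero_if_test_integrals_zero[OF assms(1)])
    show "set_integrable lebesgue C (\<lambda>z. p z - q z)" if "compact C" "C \<subseteq> U" for C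
      by (intro set_integral_diff loc_L2_set_integrable[OF _ that] assms)
    fix \<phi> assume t: "test_function U \<phi>"
    then obtain C where C: "compact C" "C \<subseteq> U" "\<And>z. z \<notin> C \<Longrightarrow> \<phi> z = 0" and \<phi>: "cont_diff \<phi>"
      unfolding test_function_iff by auto
    have U_UNIV: "(LINT z:U|lebesgue. \<phi> z *\<^sub>R r z) = (LINT z|lebesgue. \<phi> z *\<^sub>R r z)" for r :: "complex \<Rightarrow> complex"
      unfolding set_lebesgue_integral_def
      by (rule Bochner_Integration.integral_cong) (use C in \<open>auto simp: indicator_def\<close>)
    have int: "integrable lebesgue (\<lambda>z. \<phi> z *\<^sub>R r z)" if "loc_L2 U r" for r
      by (rule integrable_test_mult[OF C(1,3)])
         (simp_all add: cont_diff_continuous \<phi> loc_L2_set_integrable[OF that C(1,2)])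
    have "- (LINT z:U|lebesgue. \<phi> z *\<^sub>R p z) = - (LINT z:U|lebesgue. \<phi> z *\<^sub>R q z)"
      using assms(4,5) t unfolding weak_deriv_def by metis
    then show "(LINT z|lebesgue. \<phi> z *\<^sub>R (p z - q z)) = 0"
      using int[OF assms(2)] int[OF assms(3)] by (simp add: U_UNIV scaleR_diff_right)
  qed
  then show ?thesis by simp
qed

section \<open>Classical derivatives are weak derivatives\<close>


lemma continuous_imp_loc_L2:
  assumes "continuous_on U p" shows "loc_L2 U p"
  unfolding loc_L2_def
proof (intro allI impI conjI)
  fix C assume "compact C \<and> C \<subseteq> U"
  then have C: "compact C" "continuous_on C p" using assms continuous_on_subset by blast+
  have "integrable lborel (\<lambda>z. indicator C z *\<^sub>R p z)"
    by (rule borel_integrable_compact[OF C])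
  then show "set_borel_measurable lebesgue C p"
    unfolding set_borel_measurable_def by (auto intro: measurable_completion)
  have "integrable lborel (\<lambda>z. indicator C z *\<^sub>R (cmod (p z))\<^sup>2)"
    by (rule borel_integrable_compact[OF C(1)]) (intro continuous_intros C)
  then show "set_integrable lebesgue C (\<lambda>z. (cmod (p z))\<^sup>2)"
    unfolding set_integrable_def by (subst integrable_completion) auto
qed

text \<open>The difference quotients of \<open>F\<close> in the direction \<open>e\<close> have integral zero because Lebesgue measure is
  translation invariant. They converge to the directional derivative, they are bounded by the mean value
  inequality, and they are all supported in one ball; so dominated convergence applies.\<close>

lemma integral_directional_derivative_zero:
  fixes F :: "complex \<Rightarrow> complex"
  assumes F: "\<And>z. (F has_derivative F' z) (at z)" and cont: "continuous_on UNIV (\<lambda>z. F' z e)"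
    and C: "compact C" "\<And>z. z \<notin> C \<Longrightarrow> F z = 0" 
  shows "integrable lebesgue (\<lambda>z. F' z e)" "(LINT z|lebesgue. F' z e) = 0"
proof -
  have Fc: "continuous_on UNIV F"
    by (meson F has_derivative_continuous continuous_at_imp_continuous_on)
  have C': "F' z e = 0" if "z \<notin> C" for z
  proof -
    have "((\<lambda>_. 0) has_derivative F' z) (at z)"
      by (rule has_derivative_transform_within_open[OF F, where s="- C"])
         (use C that in \<open>auto simp: compact_imp_closed\<close>)
    then have "F' z = (\<lambda>_. 0)" by (rule has_derivative_unique) simp
    then show ?thesis by simp
  qed
  have "bounded ((\<lambda>z. F' z e) ` C)"
    by (intro compact_imp_bounded compact_continuous_image continuous_on_subset[OF cont] C) auto
  then obtain B0 where B0: "\<And>z. z \<in> C \<Longrightarrow> norm (F' z e) \<le> B0" unfolding bounded_iff by auto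
  define B where "B = max B0 0"
  have B: "norm (F' z e) \<le> B" for z using B0[of z] C'[of z] unfolding B_def by (cases "z \<in> C") auto
  obtain R where R: "\<And>z. z \<in> C \<Longrightarrow> norm z \<le> R" 
    using compact_imp_bounded[OF C(1)] unfolding bounded_iff by auto
  define q where "q = (\<lambda>(n::nat) z. real (Suc n) *\<^sub>R (F (z + e /\<^sub>R real (Suc n)) - F z))"
  let ?Q = "cball 0 (R + norm e) :: complex set"
  have small: "norm (e /\<^sub>R real (Suc n)) \<le> norm e" for n
    by (simp add: divide_inverse[symmetric] mult_left_le_one_le inverse_le_1_iff)
  have q0: "q n z = 0" if "z \<notin> ?Q" for n z
  proof -
    have "norm z > R + norm e" using that by simp
    then have "norm z > R" "norm (z + e /\<^sub>R real (Suc n)) > R"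
      using small[of n] norm_ge_zero[of e]
        norm_triangle_ineq4[of "z + e /\<^sub>R real (Suc n)" "e /\<^sub>R real (Suc n)"]
      unfolding add_diff_cancel_right' by linarith+
    then have "z \<notin> C" "z + e /\<^sub>R real (Suc n) \<notin> C" using R by (meson not_le)+
    then show ?thesis by (simp add: q_def C)
  qed
  have D: "((\<lambda>s. F (z + s *\<^sub>R e)) has_vector_derivative F' (z + s *\<^sub>R e) e) (at s)" for z s
  proof -
    have "((\<lambda>s. z + s *\<^sub>R e) has_derivative (\<lambda>h. h *\<^sub>R e)) (at s)"
      by (auto intro!: derivative_eq_intros)
    from has_derivative_compose[OF this F]
    have "((\<lambda>s. F (z + s *\<^sub>R e)) has_derivative (\<lambda>h. F' (z + s *\<^sub>R e) (h *\<^sub>R e))) (at s)" .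
    then show ?thesis unfolding has_vector_derivative_def
      by (simp add: linear_scale[OF has_derivative_linear[OF F]])
  qed
  have qB: "norm (q n z) \<le> B" for n z
  proof -
    define t where "t = 1 / real (Suc n)"
    have t: "t > 0" by (simp add: t_def)
    have "norm (F (z + t *\<^sub>R e) - F (z + 0 *\<^sub>R e)) \<le> B * t - B * 0"
    proof (rule differentiable_bound_general[OF t, where f'="\<lambda>s. F' (z + s *\<^sub>R e) e" and \<phi>'="\<lambda>_. B"])
      show "continuous_on {0..t} (\<lambda>s. F (z + s *\<^sub>R e))"
        by (intro continuous_on_compose2[OF Fc] continuous_intros) auto
    qed (auto intro!: continuous_intros D B derivative_eq_intros)
    moreover have "q n z = (1 / t) *\<^sub>R (F (z + t *\<^sub>R e) - F z)"
      by (simp add: q_def t_def inverse_eq_divide del: of_nat_Suc)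
    then have "norm (q n z) = norm (F (z + t *\<^sub>R e) - F z) / t"
      using t by simp
    ultimately show ?thesis using t by (simp add: pos_divide_le_eq)
  qed
  have qlim: "(\<lambda>n. q n z) \<longlonglongrightarrow> F' z e" for z
  proof -
    let ?G = "\<lambda>s. F (z + s *\<^sub>R e)"
    have "((\<lambda>s. norm (?G s - ?G 0 - (s - 0) *\<^sub>R F' z e) / norm (s - 0)) \<longlongrightarrow> 0) (at 0)"
      using D[of z 0] unfolding has_vector_derivative_def has_derivative_iff_norm by simp
    moreover have "filterlim (\<lambda>n. inverse (real (Suc n))) (at 0) sequentially"
      unfolding filterlim_at using LIMSEQ_inverse_real_of_nat by auto
    ultimately have "(\<lambda>n. norm (?G (inverse (real (Suc n))) - ?G 0 - (inverse (real (Suc n)) - 0) *\<^sub>R F' z e)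
        / norm (inverse (real (Suc n)) - 0)) \<longlonglongrightarrow> 0"
      by (rule filterlim_compose)
    also have "(\<lambda>n. norm (?G (inverse (real (Suc n))) - ?G 0 - (inverse (real (Suc n)) - 0) *\<^sub>R F' z e)
        / norm (inverse (real (Suc n)) - 0)) = (\<lambda>n. norm (q n z - F' z e))"
    proof
      fix n
      let ?t = "real (Suc n)"
      have "q n z - F' z e = ?t *\<^sub>R (?G (inverse ?t) - ?G 0 - (inverse ?t - 0) *\<^sub>R F' z e)"
        by (simp add: q_def scaleR_diff_right del: of_nat_Suc)
      then have "norm (q n z - F' z e) = ?t * norm (?G (inverse ?t) - ?G 0 - (inverse ?t - 0) *\<^sub>R F' z e)"
        by (simp del: of_nat_Suc)
      then show "norm (?G (inverse ?t) - ?G 0 - (inverse ?t - 0) *\<^sub>R F' z e) / norm (inverse ?t - 0)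
          = norm (q n z - F' z e)"
        by (simp add: divide_inverse mult.commute del: of_nat_Suc)
    qed
    finally show ?thesis by (simp add: tendsto_norm_zero_iff LIM_zero_iff)
  qed
  have Fint: "integrable lborel F"
  proof -
    have "F = (\<lambda>z. indicator C z *\<^sub>R F z)" using C(2) by (auto simp: indicator_def)
    moreover have "integrable lborel (\<lambda>z. indicator C z *\<^sub>R F z)"
      by (rule borel_integrable_compact[OF C(1) continuous_on_subset[OF Fc]]) auto
    ultimately show ?thesis by simp
  qed
  have shift: "integrable lborel (\<lambda>z. F (z + c))" "(LINT z|lborel. F (z + c)) = (LINT z|lborel. F z)" for c
  proof -
    have [measurable]: "F \<in> borel_measurable borel" using Fint by auto
    have "integrable (distr lborel borel ((+) c)) F" using Fint by (simp add: lborel_distr_plus)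
    then show "integrable lborel (\<lambda>z. F (z + c))" by (subst (asm) integrable_distr_eq) (auto simp: add.commute)
    have "(LINT z|lborel. F z) = (LINT z|distr lborel borel ((+) c). F z)" by (simp add: lborel_distr_plus)
    also have "\<dots> = (LINT z|lborel. F (c + z))" by (rule integral_distr) auto
    finally show "(LINT z|lborel. F (z + c)) = (LINT z|lborel. F z)" by (simp add: add.commute)
  qed
  have qint: "(LINT z|lborel. q n z) = 0" for n
    unfolding q_def using shift Fint by simp
  let ?w = "\<lambda>z. indicator ?Q z *\<^sub>R B"
  have w: "integrable lborel ?w" by (rule borel_integrable_compact) auto
  have dom: "AE z in lborel. norm (q n z) \<le> ?w z" for n
  proof (rule AE_I2)
    show "norm (q n z) \<le> ?w z" for z using qB[of n z] q0[of z n] by (cases "z \<in> ?Q") auto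
  qed
  have meas: "(\<lambda>z. F' z e) \<in> borel_measurable lborel"
    using borel_measurable_continuous_onI[OF cont] by simp
  have qmeas: "q n \<in> borel_measurable lborel" for n unfolding q_def
    using shift(1) Fint by (intro borel_measurable_integrable) simp
  have lim: "AE z in lborel. (\<lambda>n. q n z) \<longlonglongrightarrow> F' z e" using qlim by (intro AE_I2)
  have int: "integrable lborel (\<lambda>z. F' z e)"
    by (rule integrable_dominated_convergence[OF meas qmeas w lim dom])
  have conv: "(\<lambda>n. LINT z|lborel. q n z) \<longlonglongrightarrow> (LINT z|lborel. F' z e)"
    by (rule integral_dominated_convergence[OF meas qmeas w lim dom])
  from int show "integrable lebesgue (\<lambda>z. F' z e)" using meas by (subst integrable_completion) auto
  have "(LINT z|lborel. F' z e) = 0" using conv by (simp add: qint LIMSEQ_const_iff)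
  then show "(LINT z|lebesgue. F' z e) = 0" using meas by (subst integral_completion) auto
qed

text \<open>Integration by parts: apply the preceding lemma to the product of \<open>f\<close> with the test function, extended
  by zero outside \<open>U\<close>.\<close>

lemma weak_deriv_classical:
  fixes f :: "complex \<Rightarrow> complex"
  assumes U: "open U" and f: "\<And>z. z \<in> U \<Longrightarrow> (f has_derivative f' z) (at z)"
    and cont: "continuous_on U (\<lambda>z. f' z e)"
  shows "weak_deriv U e f (\<lambda>z. f' z e)"
  unfolding weak_deriv_def
proof (intro allI impI)
  fix \<phi> assume "test_function U \<phi>"
  then obtain D C where D: "continuous_on UNIV D" "\<And>z. (\<phi> has_derivative blinfun_apply (D z)) (at z)"
    and C: "compact C" "C \<subseteq> U" "\<And>z. z \<notin> C \<Longrightarrow> \<phi> z = 0"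
    unfolding test_function_def by auto
  have fc: "continuous_on U f"
    by (meson f has_derivative_continuous continuous_at_imp_continuous_on)
  have \<phi>c: "continuous_on UNIV \<phi>"
    by (meson D(2) has_derivative_continuous continuous_at_imp_continuous_on)
  have fr: "frechet_derivative \<phi> (at z) = blinfun_apply (D z)" for z
    using frechet_derivative_at[OF D(2)] by simp
  have D0: "blinfun_apply (D z) = (\<lambda>_. 0)" if "z \<notin> C" for z
  proof -
    have "((\<lambda>_. 0) has_derivative blinfun_apply (D z)) (at z)"
      by (rule has_derivative_transform_within_open[OF D(2), where s="- C"])
         (use C that in \<open>auto simp: compact_imp_closed\<close>)
    then show ?thesis by (rule has_derivative_unique) simp
  qed
  define F where "F = (\<lambda>z. \<phi> z *\<^sub>R f z)"
  define F' where "F' = (\<lambda>z h. if z \<in> C then D z h *\<^sub>R f z + \<phi> z *\<^sub>R f' z h else 0)"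
  have F'U: "F' z = (\<lambda>h. D z h *\<^sub>R f z + \<phi> z *\<^sub>R f' z h)" if "z \<in> U" for z
    using D0[of z] C(3)[of z] by (auto simp: F'_def fun_eq_iff)
  have F: "(F has_derivative F' z) (at z)" for z
  proof (cases "z \<in> U")
    case True
    show ?thesis unfolding F_def F'U[OF True]
      using has_derivative_scaleR[OF D(2)[of z] f[OF True]] by (simp add: add.commute)
  next
    case False
    then have z: "z \<in> - C" using C by auto
    have "((\<lambda>_. 0) has_derivative (\<lambda>_. 0)) (at z)" by simp
    then have "(F has_derivative (\<lambda>_. 0)) (at z)"
      by (rule has_derivative_transform_within_open[where s="- C"])
         (use C z in \<open>auto simp: compact_imp_closed F_def\<close>)
    then show ?thesis using z by (simp add: F'_def)
  qed
  have "continuous_on (U \<union> - C) (\<lambda>z. F' z e)"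
  proof (rule continuous_on_open_Un)
    have "continuous_on U (\<lambda>z. D z e *\<^sub>R f z + \<phi> z *\<^sub>R f' z e)"
      by (intro continuous_on_add continuous_on_scaleR blinfun.continuous_on continuous_on_const fc cont
           continuous_on_subset[OF D(1)] continuous_on_subset[OF \<phi>c]) auto
    then show "continuous_on U (\<lambda>z. F' z e)"
      by (rule continuous_on_eq) (simp add: F'U)
    have "continuous_on (- C) (\<lambda>z. 0::complex)" by simp
    then show "continuous_on (- C) (\<lambda>z. F' z e)"
      by (rule continuous_on_eq) (simp add: F'_def)
  qed (use U C in \<open>auto simp: compact_imp_closed\<close>)
  moreover have "U \<union> - C = UNIV" using C by auto
  ultimately have F'c: "continuous_on UNIV (\<lambda>z. F' z e)" by simp
  have zero: "(LINT z|lebesgue. F' z e) = 0"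
    by (rule integral_directional_derivative_zero(2)[OF F F'c C(1)]) (simp add: F_def C)
  have i1: "integrable lebesgue (\<lambda>z. D z e *\<^sub>R f z)"
    by (rule integrable_test_mult[OF C(1)])
       (use D0 in \<open>auto intro!: blinfun.continuous_on D(1) continuous_on_const loc_L2_set_integrable[OF continuous_imp_loc_L2[OF fc] C(1,2)]\<close>)
  have i2: "integrable lebesgue (\<lambda>z. \<phi> z *\<^sub>R f' z e)"
    by (rule integrable_test_mult[OF C(1,3) \<phi>c])
       (auto intro!: loc_L2_set_integrable[OF continuous_imp_loc_L2[OF cont] C(1,2)])
  have "F' z e = D z e *\<^sub>R f z + \<phi> z *\<^sub>R f' z e" for z
    using D0[of z] C(3)[of z] by (auto simp: F'_def)
  with zero i1 i2 have "(LINT z|lebesgue. D z e *\<^sub>R f z) = - (LINT z|lebesgue. \<phi> z *\<^sub>R f' z e)"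
    by (simp add: add_eq_0_iff2)
  moreover have "(LINT z:U|lebesgue. D z e *\<^sub>R f z) = (LINT z|lebesgue. D z e *\<^sub>R f z)"
    unfolding set_lebesgue_integral_def
    by (intro Bochner_Integration.integral_cong refl) (metis D0 C(2) indicator_simps scaleR_one scaleR_zero_left subsetD)
  moreover have "(LINT z:U|lebesgue. \<phi> z *\<^sub>R f' z e) = (LINT z|lebesgue. \<phi> z *\<^sub>R f' z e)"
    unfolding set_lebesgue_integral_def
    by (rule Bochner_Integration.integral_cong) (use C in \<open>auto simp: indicator_def\<close>)
  ultimately show "(LINT z:U|lebesgue. frechet_derivative \<phi> (at z) e *\<^sub>R f z) =
        - (LINT z:U|lebesgue. \<phi> z *\<^sub>R f' z e)" by (simp add: fr)
qed

section \<open>Derivatives, dilatation and Pre-Schwarzian of a harmonic mapping\<close>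


lemma harmonic_has_derivative:
  assumes "harmonic_decomp f h g" "z \<in> \<D>"
  shows "(f has_derivative (\<lambda>e. deriv h z * e + cnj (deriv g z * e))) (at z)"
proof -
  have "(h has_field_derivative deriv h z) (at z)" "(g has_field_derivative deriv g z) (at z)"
    using assms unfolding harmonic_decomp_def by (auto intro: holomorphic_derivI)
  then have "((\<lambda>z. h z + cnj (g z)) has_derivative (\<lambda>e. deriv h z * e + cnj (deriv g z * e))) (at z)"
    unfolding has_field_derivative_def
    by (intro has_derivative_add bounded_linear.has_derivative[OF bounded_linear_cnj])
  then show ?thesis
    by (rule has_derivative_transform_within_open[where s=\<D>])
       (use assms in \<open>auto simp: harmonic_decomp_def\<close>)
qed

text \<open>The complex linear and the antilinear part of the real differential of \<open>f\<close> are determined by \<open>f\<close>. So the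
  properties that membership in \<^const>\<open>S_H\<close> grants to some decomposition hold for every decomposition.\<close>

lemma harmonic_decomp_deriv_unique:
  assumes "harmonic_decomp f h g" "harmonic_decomp f h\<^sub>1 g\<^sub>1" "z \<in> \<D>"
  shows "deriv h z = deriv h\<^sub>1 z" "deriv g z = deriv g\<^sub>1 z"
proof -
  have eq: "deriv h z * e + cnj (deriv g z * e) = deriv h\<^sub>1 z * e + cnj (deriv g\<^sub>1 z * e)" for e
    using has_derivative_unique[OF harmonic_has_derivative[OF assms(1,3)] harmonic_has_derivative[OF assms(2,3)]]
    by (rule fun_cong)
  from eq[of 1] eq[of \<i>] show "deriv h z = deriv h\<^sub>1 z" "deriv g z = deriv g\<^sub>1 z"
    by (auto simp: complex_eq_iff)
qed

text \<open>Differentiating \<open>ln (\<bar>h'\<bar>\<^sup>2 (1 - \<bar>\<omega>\<bar>\<^sup>2))\<close> with respect to \<open>z\<close> gives the logarithmic derivative of \<open>h'\<close> from the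
  first factor, and from the second factor the negative of the term that is added here.\<close>

lemma pre_schwarzian_plus_dilatation:
  assumes "h holomorphic_on \<D>" "g holomorphic_on \<D>" "z \<in> \<D>" "jacobian h g z > 0"
  shows "pre_schwarzian h g z + deriv (dilatation h g) z * cnj (dilatation h g z) /
           of_real (1 - (cmod (dilatation h g z))\<^sup>2) = deriv (deriv h) z / deriv h z"
proof -
  define a b a' b' where "a = deriv h z" "b = deriv g z" "a' = deriv (deriv h) z" "b' = deriv (deriv g) z"
  note ab = this
  have D: "(deriv h has_field_derivative a') (at z)" "(deriv g has_field_derivative b') (at z)"
    unfolding ab using assms by (auto intro!: holomorphic_derivI[where S=\<D>] holomorphic_deriv)
  have J: "jacobian h g z = (cmod a)\<^sup>2 - (cmod b)\<^sup>2" by (simp add: jacobian_def ab)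
  have a0: "a \<noteq> 0" using assms(4) J by auto
  have sq: "((\<lambda>z. (cmod (F z))\<^sup>2) has_derivative (\<lambda>e. 2 * Re (F' * cnj (F z) * e))) (at z)"
    if "(F has_field_derivative F') (at z)" for F F'
  proof -
    have "(F has_derivative (\<lambda>e. F' * e)) (at z)" using that unfolding has_field_derivative_def .
    then have "((\<lambda>z. F z \<bullet> F z) has_derivative (\<lambda>e. F z \<bullet> (F' * e) + (F' * e) \<bullet> F z)) (at z)"
      by (intro has_derivative_inner)
    moreover have "(\<lambda>e. F z \<bullet> (F' * e) + (F' * e) \<bullet> F z) = (\<lambda>e. 2 * Re (F' * cnj (F z) * e))"
      by (auto simp: inner_complex_def algebra_simps)
    ultimately show ?thesis by (simp add: power2_norm_eq_inner)
  qed
  define N where "N = a' * cnj a - b' * cnj b"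
  have "(jacobian h g has_derivative (\<lambda>e. 2 * Re (a' * cnj a * e) - 2 * Re (b' * cnj b * e))) (at z)"
    unfolding jacobian_def ab(1,2) using sq[OF D(1)] sq[OF D(2)] by (intro has_derivative_diff) auto
  moreover have "(\<lambda>e. 2 * Re (a' * cnj a * e) - 2 * Re (b' * cnj b * e)) = (\<lambda>e. 2 * Re (N * e))"
    by (auto simp: N_def algebra_simps)
  ultimately have jacD: "(jacobian h g has_derivative (\<lambda>e. 2 * Re (N * e))) (at z)" by simp
  have "((\<lambda>z. ln (jacobian h g z)) has_derivative (\<lambda>e. 2 * Re (N * e) * inverse (jacobian h g z))) (at z)"
    by (rule has_derivative_ln[where g="jacobian h g", OF assms(4) jacD])
  then have "((\<lambda>z. complex_of_real (ln (jacobian h g z))) has_derivative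
      (\<lambda>e. complex_of_real (2 * Re (N * e) * inverse (jacobian h g z)))) (at z)"
    by (rule bounded_linear.has_derivative[OF bounded_linear_of_real])
  then have fr: "frechet_derivative (\<lambda>z. complex_of_real (ln (jacobian h g z))) (at z) =
      (\<lambda>e. complex_of_real (2 * Re (N * e) * inverse (jacobian h g z)))"
    by (rule frechet_derivative_at[symmetric])
  have pre: "pre_schwarzian h g z = N / of_real (jacobian h g z)"
  proof -
    let ?j = "complex_of_real (inverse (jacobian h g z))"
    have "pre_schwarzian h g z = (complex_of_real (Re N) + \<i> * complex_of_real (Im N)) * ?j"
      unfolding pre_schwarzian_def wirtinger_deriv_def fr by (simp add: algebra_simps)
    then show ?thesis by (simp add: complex_eq[symmetric] divide_inverse)
  qed
  have dil: "dilatation h g z = b / a" by (simp add: dilatation_def ab)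
  have "((\<lambda>z. deriv g z / deriv h z) has_field_derivative (b' * a - b * a') / (a * a)) (at z)"
    using DERIV_divide[OF D(2,1)] a0 by (simp add: ab)
  then have dil': "deriv (dilatation h g) z = (b' * a - b * a') / (a * a)"
    unfolding dilatation_def by (rule DERIV_imp_deriv)
  have Jc: "complex_of_real (jacobian h g z) = a * cnj a - b * cnj b"
    unfolding J by (simp only: of_real_diff complex_norm_square)
  have J0: "a * cnj a - b * cnj b \<noteq> 0" using assms(4) Jc by (metis of_real_eq_0_iff less_irrefl)
  have om: "complex_of_real (1 - (cmod (b / a))\<^sup>2) = (a * cnj a - b * cnj b) / (a * cnj a)"
  proof -
    have "complex_of_real (1 - (cmod (b / a))\<^sup>2) = 1 - (b / a) * cnj (b / a)"
      by (simp only: of_real_diff of_real_1 complex_norm_square)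
    also have "\<dots> = (a * cnj a - b * cnj b) / (a * cnj a)" using a0 by (simp add: field_simps)
    finally show ?thesis .
  qed
  have a0': "cnj a \<noteq> 0" using a0 by simp
  have second: "(b' * a - b * a') / (a * a) * cnj (b / a) / ((a * cnj a - b * cnj b) / (a * cnj a))
     = (b' * a - b * a') * cnj b / (a * (a * cnj a - b * cnj b))"
    using a0 a0' J0 by simp
  have "(a' * cnj a - b' * cnj b) / (a * cnj a - b * cnj b) + (b' * a - b * a') * cnj b / (a * (a * cnj a - b * cnj b))
     = (a' * cnj a - b' * cnj b) * a / (a * (a * cnj a - b * cnj b)) + (b' * a - b * a') * cnj b / (a * (a * cnj a - b * cnj b))"
    using a0 by simp
  also have "\<dots> = a' * (a * cnj a - b * cnj b) / (a * (a * cnj a - b * cnj b))"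
    unfolding add_divide_distrib[symmetric] by (rule arg_cong[where f="\<lambda>t. t / _"]) (simp add: algebra_simps)
  also have "\<dots> = a' / a" using J0 by simp
  finally show ?thesis unfolding pre N_def dil dil' Jc om second by (simp add: ab)
qed

text \<open>The distortion inequality holds almost everywhere for the classical derivatives, hence everywhere by
  continuity, as a nonempty open set is not negligible. Since \<open>\<bar>h'\<bar>\<^sup>2 - \<bar>g'\<bar>\<^sup>2\<close> is positive, a factor
  \<open>\<bar>h'\<bar> + \<bar>g'\<bar>\<close> can be cancelled.\<close>

lemma quasiconformal_harmonic_dilatation:
  assumes qc: "quasiconformal_on K \<D> f" and f: "harmonic_decomp f h g"
    and jac: "\<And>z. z \<in> \<D> \<Longrightarrow> jacobian h g z > 0" and z: "z \<in> \<D>"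
  shows "(K + 1) * cmod (deriv g z) \<le> (K - 1) * cmod (deriv h z)"
proof -
  define f' where "f' = (\<lambda>z e. deriv h z * e + cnj (deriv g z * e))"
  have hol: "h holomorphic_on \<D>" "g holomorphic_on \<D>" using f by (auto simp: harmonic_decomp_def)
  then have cont: "continuous_on \<D> (deriv h)" "continuous_on \<D> (deriv g)"
    by (auto intro!: holomorphic_on_imp_continuous_on holomorphic_deriv)
  have cont': "continuous_on \<D> (\<lambda>z. f' z e)" for e
    unfolding f'_def by (intro continuous_intros cont)
  obtain fx fy where W: "W12_loc \<D> f fx fy" and ineq:
    "AE z in lebesgue. z \<in> \<D> \<longrightarrow> (let fz = (fx z - \<i> * fy z) / 2; fzb = (fx z + \<i> * fy z) / 2
            in (cmod fz + cmod fzb)\<^sup>2 \<le> K * \<bar>(cmod fz)\<^sup>2 - (cmod fzb)\<^sup>2\<bar>)"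
    using qc unfolding quasiconformal_on_def by blast
  have weak: "weak_deriv \<D> e f (\<lambda>z. f' z e)" for e
    using weak_deriv_classical[of \<D> f f' e] harmonic_has_derivative[OF f] cont'
    by (simp add: f'_def)
  have fx: "AE z in lebesgue. z \<in> \<D> \<longrightarrow> fx z = f' z 1" and fy: "AE z in lebesgue. z \<in> \<D> \<longrightarrow> fy z = f' z \<i>"
    using W weak_deriv_unique[OF open_ball _ continuous_imp_loc_L2[OF cont'] _ weak]
    unfolding W12_loc_def by blast+
  let ?P = "\<lambda>z. (cmod (deriv h z) + cmod (deriv g z))\<^sup>2 \<le> K * \<bar>(cmod (deriv h z))\<^sup>2 - (cmod (deriv g z))\<^sup>2\<bar>"
  define S where "S = {z \<in> \<D>. \<not> ?P z}"
  have "AE z in lebesgue. z \<in> \<D> \<longrightarrow> ?P z"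
    using ineq fx fy
  proof eventually_elim
    case (elim z)
    have "(f' z 1 - \<i> * f' z \<i>) / 2 = deriv h z" "(f' z 1 + \<i> * f' z \<i>) / 2 = cnj (deriv g z)"
      by (auto simp: f'_def complex_eq_iff)
    with elim show ?case by (auto simp: Let_def)
  qed
  then have "AE z in lebesgue. z \<notin> S" by (auto simp: S_def elim!: eventually_mono)
  moreover have op: "open S"
  proof -
    have "open ((\<lambda>z. (cmod (deriv h z) + cmod (deriv g z))\<^sup>2 - K * \<bar>(cmod (deriv h z))\<^sup>2 - (cmod (deriv g z))\<^sup>2\<bar>) -` {0<..} \<inter> \<D>)"
      by (intro continuous_on_open_vimage[THEN iffD1, rule_format] continuous_intros cont) auto
    moreover have "S = (\<lambda>z. (cmod (deriv h z) + cmod (deriv g z))\<^sup>2 - K * \<bar>(cmod (deriv h z))\<^sup>2 - (cmod (deriv g z))\<^sup>2\<bar>) -` {0<..} \<inter> \<D>"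
      by (auto simp: S_def)
    ultimately show ?thesis by simp
  qed
  ultimately have "negligible S"
    by (subst negligible_iff_null_sets) (auto simp: AE_iff_null_sets)
  with op have "S = {}" using open_not_negligible by blast
  with z have P: "?P z" by (auto simp: S_def)
  have J: "(cmod (deriv h z))\<^sup>2 - (cmod (deriv g z))\<^sup>2 > 0" using jac[OF z] by (simp add: jacobian_def)
  then have hpos: "cmod (deriv h z) > 0" by (auto simp: not_less)
  let ?a = "cmod (deriv h z)" and ?b = "cmod (deriv g z)"
  have "(?a + ?b) * (?a + ?b) \<le> (?a + ?b) * (K * (?a - ?b))"
    using P J by (simp add: power2_eq_square algebra_simps)
  then have "?a + ?b \<le> K * (?a - ?b)"
    using hpos by (subst (asm) mult_le_cancel_left_pos) (auto intro: add_pos_nonneg)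
  then show ?thesis by (simp add: algebra_simps)
qed

section \<open>Length of radial arcs\<close>

text \<open>Only such a majorant \<open>\<Phi>\<close> of the increments is needed: the sums over partitions telescope.\<close>

lemma curve_length_le:
  assumes "a \<le> b" and d: "\<And>x y. a \<le> x \<Longrightarrow> x \<le> y \<Longrightarrow> y \<le> b \<Longrightarrow> dist (\<gamma> x) (\<gamma> y) \<le> \<Phi> y - \<Phi> x"
  shows "curve_length \<gamma> a b \<le> ereal (\<Phi> b - \<Phi> a)"
  unfolding curve_length_def
proof (rule SUP_least, clarsimp)
  fix n :: nat and t :: "nat \<Rightarrow> real" assume t: "mono_on {..n} t" "t ` {..n} \<subseteq> {a..b}"
  have mem: "a \<le> t i" "t i \<le> b" if "i \<le> n" for i using t(2) that by auto
  have mono: "\<Phi> x \<le> \<Phi> y" if "a \<le> x" "x \<le> y" "y \<le> b" for x y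
    using d[OF that] zero_le_dist[of "\<gamma> x" "\<gamma> y"] by linarith
  have "(\<Sum>i<n. dist (\<gamma> (t i)) (\<gamma> (t (Suc i)))) \<le> (\<Sum>i<n. \<Phi> (t (Suc i)) - \<Phi> (t i))"
    by (intro sum_mono d mem mono_onD[OF t(1)]) auto
  also have "\<dots> = \<Phi> (t n) - \<Phi> (t 0)" by (rule sum_lessThan_telescope)
  also have "\<dots> \<le> \<Phi> b - \<Phi> a"
    using mono[of "t n" b] mono[of a "t 0"] mem[of n] mem[of 0] by simp
  finally show "(\<Sum>i<n. dist (\<gamma> (t i)) (\<gamma> (t (Suc i)))) \<le> \<Phi> b - \<Phi> a" .
qed

lemma norm_exp_minus_1_le:
  fixes z :: complex
  assumes "cmod z \<le> 1/2" shows "cmod (exp z - 1) \<le> 2 * cmod z"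
proof -
  have "cmod (exp z - exp 0) \<le> 2 * cmod (z - 0)"
    by (rule field_differentiable_bound[where S="cball 0 (1/2)" and f'=exp])
       (use assms in \<open>auto intro: has_field_derivative_at_within DERIV_exp exp_bound_half simp del: norm_exp_eq_Re\<close>)
  then show ?thesis by simp
qed

text \<open>In the application \<open>exp \<circ> L = h'\<close>. Along a radius the derivative of \<open>Re L\<close> is at most \<open>2p/(1 - x\<^sup>2)\<close>, whose
  integral is \<open>p ln ((1 + x)/(1 - x))\<close>. The factor \<open>2\<close> absorbs the contribution of the numerators \<open>1 + x\<close>.\<close>

lemma radial_growth:
  fixes L :: "complex \<Rightarrow> complex"
  assumes hol: "L holomorphic_on \<D>" and p: "0 \<le> p" "p \<le> 1"
    and bd: "\<And>w. w \<in> \<D> \<Longrightarrow> (1 - (cmod w)\<^sup>2) * cmod (deriv L w) \<le> 2 * p"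
    and z: "z \<in> \<D>" and st: "0 \<le> s" "s \<le> t" "t \<le> 1"
  shows "cmod (exp (L (of_real t * z))) \<le>
     2 * cmod (exp (L (of_real s * z))) * ((1 - s * cmod z) / (1 - t * cmod z)) powr p"
proof -
  define r where "r = cmod z"
  have r: "0 \<le> r" "r < 1" using z by (auto simp: r_def)
  \<comment> \<open>Monotonicity of \<open>\<psi>\<close> on \<open>[0,1]\<close> expresses the integrated bound on the derivative of \<open>Re L\<close>.\<close>
  define \<psi> where "\<psi> = (\<lambda>x. p * (ln (1 + x * r) - ln (1 - x * r)) - Re (L (of_real x * z)))"
  have xr: "0 \<le> x * r" "x * r < 1" if "0 \<le> x" "x \<le> 1" for x
    using that r mult_left_le_one_le[of r x] by auto
  have in_disk: "of_real x * z \<in> \<D>" if "0 \<le> x" "x \<le> 1" for x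
    using xr[OF that] that by (simp add: norm_mult r_def)
  have "\<psi> s \<le> \<psi> t"
  proof (rule DERIV_nonneg_imp_nondecreasing[OF st(2)])
    fix x assume x: "s \<le> x" "x \<le> t"
    then have x01: "0 \<le> x" "x \<le> 1" using st by auto
    let ?w = "of_real x * z"
    have "(L has_field_derivative deriv L ?w) (at ?w)"
      using hol in_disk[OF x01] by (intro holomorphic_derivI) auto
    moreover have "((\<lambda>x. of_real x * z) has_vector_derivative z) (at x)"
      by (auto intro!: derivative_eq_intros simp: has_vector_derivative_def scaleR_conv_of_real)
    ultimately have "((\<lambda>x. L (of_real x * z)) has_vector_derivative z * deriv L ?w) (at x)"
      using field_vector_diff_chain_at[of "\<lambda>x. of_real x * z" z x L "deriv L ?w"] by (simp add: o_def)
    then have "((\<lambda>x. Re (L (of_real x * z))) has_real_derivative Re (z * deriv L ?w)) (at x)"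
      unfolding has_real_derivative_iff_has_vector_derivative
      using bounded_linear.has_vector_derivative[OF bounded_linear_Re] by blast
    moreover have "((\<lambda>x. p * (ln (1 + x * r) - ln (1 - x * r))) has_real_derivative
        p * (r / (1 + x * r) + r / (1 - x * r))) (at x)"
      using xr[OF x01] by (auto intro!: derivative_eq_intros simp: field_simps)
    ultimately have "(\<psi> has_real_derivative p * (r / (1 + x * r) + r / (1 - x * r)) - Re (z * deriv L ?w)) (at x)"
      unfolding \<psi>_def by (intro DERIV_diff)
    moreover have "Re (z * deriv L ?w) \<le> p * (r / (1 + x * r) + r / (1 - x * r))"
    proof -
      have pos: "1 - (x * r)\<^sup>2 > 0" using xr[OF x01] by (simp add: power_less_one_iff abs_square_less_1)
      have "r / (1 + x * r) + r / (1 - x * r) = 2 * r / (1 - (x * r)\<^sup>2)"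
        using xr[OF x01] pos by (simp add: field_simps power2_eq_square)
      moreover have "(1 - (x * r)\<^sup>2) * cmod (deriv L ?w) \<le> 2 * p"
        using bd[OF in_disk[OF x01]] x01 by (simp add: norm_mult r_def power_mult_distrib)
      then have "cmod (deriv L ?w) \<le> 2 * p / (1 - (x * r)\<^sup>2)" using pos by (simp add: field_simps)
      then have "r * cmod (deriv L ?w) \<le> r * (2 * p / (1 - (x * r)\<^sup>2))" using r by (intro mult_left_mono)
      moreover have "Re (z * deriv L ?w) \<le> r * cmod (deriv L ?w)"
        using complex_Re_le_cmod[of "z * deriv L ?w"] by (simp add: norm_mult r_def)
      ultimately show ?thesis by (simp add: mult_ac)
    qed
    ultimately show "\<exists>y. (\<psi> has_real_derivative y) (at x) \<and> 0 \<le> y" by (intro exI conjI) auto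
  qed
  then have le: "Re (L (of_real t * z)) \<le> Re (L (of_real s * z)) +
      p * (ln (1 + t * r) - ln (1 + s * r)) + p * (ln (1 - s * r) - ln (1 - t * r))"
    by (simp add: \<psi>_def algebra_simps)
  have s01: "s \<le> 1" and t0: "0 \<le> t" using st by auto
  have "p * (ln (1 + t * r) - ln (1 + s * r)) \<le> 1 * (ln 2 - 0)"
  proof (intro mult_mono p)
    show "ln (1 + t * r) - ln (1 + s * r) \<le> ln 2 - 0"
      using xr[OF st(1) s01] xr[OF t0 st(3)] by (intro diff_mono) auto
    show "0 \<le> ln (1 + t * r) - ln (1 + s * r)"
      using xr[OF st(1) s01] mult_right_mono[OF st(2) r(1)] by simp
  qed auto
  with le have "cmod (exp (L (of_real t * z))) \<le>
      exp (Re (L (of_real s * z)) + ln 2 + p * (ln (1 - s * r) - ln (1 - t * r)))"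
    by simp
  also have "\<dots> = 2 * cmod (exp (L (of_real s * z))) * ((1 - s * r) / (1 - t * r)) powr p"
    using xr[OF st(1) s01] xr[OF t0 st(3)] by (simp add: exp_add powr_def ln_div)
  finally show ?thesis by (simp add: r_def)
qed

text \<open>Here the constant in the hypothesis of the theorem enters: \<open>\<bar>h'\<bar>\<close> grows along the radius at most like
  \<open>(1 - x) powr (- p)\<close>, and this is integrable up to the boundary because \<open>p < 1\<close>. The integral is comparable
  to its integrand at the starting point times the remaining length \<open>1 - s \<bar>z\<bar>\<close>.\<close>

lemma radial_arc_bound:
  assumes f: "harmonic_decomp f h g" and L: "L holomorphic_on \<D>" "\<And>w. w \<in> \<D> \<Longrightarrow> deriv h w = exp (L w)"
    and p: "0 \<le> p" "p < 1"
    and bd: "\<And>w. w \<in> \<D> \<Longrightarrow> (1 - (cmod w)\<^sup>2) * cmod (deriv L w) \<le> 2 * p"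
    and dil: "\<And>w. w \<in> \<D> \<Longrightarrow> cmod (deriv g w) \<le> cmod (deriv h w)"
    and z: "z \<in> \<D>" and s: "0 \<le> s" "s \<le> 1"
  shows "curve_length (\<lambda>t. f (of_real t * z)) s 1 \<le>
     ereal (4 / (1 - p) * cmod (deriv h (of_real s * z)) * (1 - s * cmod z))"
proof -
  define r where "r = cmod z"
  have r: "0 \<le> r" "r < 1" using z by (auto simp: r_def)
  have xr: "0 \<le> x * r" "x * r < 1" if "0 \<le> x" "x \<le> 1" for x
    using that r mult_left_le_one_le[of r x] by auto
  have in_disk: "of_real x * z \<in> \<D>" if "0 \<le> x" "x \<le> 1" for x
    using xr[OF that] that by (simp add: norm_mult r_def)
  define A where "A = 4 * cmod (deriv h (of_real s * z)) * (1 - s * r) powr p"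
  have A0: "A \<ge> 0" by (simp add: A_def)
  \<comment> \<open>An antiderivative of the bound for the speed of the arc; being nonpositive, it bounds the whole
    length beyond \<open>s\<close> by \<open>- \<Phi> s\<close>.\<close>
  define \<Phi> where "\<Phi> = (\<lambda>t. - A * (1 - t * r) powr (1 - p) / (1 - p))"
  have vec: "((\<lambda>t. f (of_real t * z)) has_vector_derivative
      (deriv h (of_real t * z) * z + cnj (deriv g (of_real t * z) * z))) (at t)"
    if t: "0 \<le> t" "t \<le> 1" for t
  proof -
    have "((\<lambda>t. of_real t * z) has_derivative (\<lambda>e. of_real e * z)) (at t)"
      by (auto intro!: derivative_eq_intros)
    from has_derivative_compose[OF this harmonic_has_derivative[OF f in_disk[OF t]]]
    show ?thesis unfolding has_vector_derivative_def
      by (rule back_subst[of "\<lambda>D. (_ has_derivative D) _"]) (auto simp: scaleR_conv_of_real algebra_simps)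
  qed
  have d: "dist (f (of_real a * z)) (f (of_real b * z)) \<le> \<Phi> b - \<Phi> a"
    if ab: "s \<le> a" "a \<le> b" "b \<le> 1" for a b
  proof (cases "a = b")
    case False
    with ab have "a < b" by simp
    have "norm (f (of_real b * z) - f (of_real a * z)) \<le> \<Phi> b - \<Phi> a"
    proof (rule differentiable_bound_general[OF \<open>a < b\<close>])
      fix t assume "a < t" "t < b"
      then have t: "s \<le> t" "0 \<le> t" "t \<le> 1" using ab s by auto
      let ?w = "of_real t * z"
      show "((\<lambda>t. f (of_real t * z)) has_vector_derivative (deriv h ?w * z + cnj (deriv g ?w * z))) (at t)"
        by (rule vec) (use t in auto)
      show "(\<Phi> has_vector_derivative A * r * (1 - t * r) powr (- p)) (at t)"
      proof -
        have "((\<lambda>t. 1 - t * r) has_real_derivative - r) (at t)"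
          by (auto intro!: derivative_eq_intros)
        from DERIV_cmult[OF DERIV_fun_powr[OF this, of "1 - p"], of "- A / (1 - p)"]
        have "((\<lambda>t. - A / (1 - p) * (1 - t * r) powr (1 - p)) has_real_derivative
            - A / (1 - p) * ((1 - p) * (1 - t * r) powr (- p) * - r)) (at t)"
          using xr[OF t(2,3)] by simp
        then show ?thesis
          unfolding has_real_derivative_iff_has_vector_derivative[symmetric] \<Phi>_def
          using p by (simp add: mult_ac)
      qed
      have "norm (deriv h ?w * z + cnj (deriv g ?w * z)) \<le> cmod (deriv h ?w) * r + cmod (deriv g ?w) * r"
        by (rule order_trans[OF norm_triangle_ineq]) (simp add: norm_mult r_def)
      also have "\<dots> \<le> cmod (deriv h ?w) * r + cmod (deriv h ?w) * r"
        using dil[OF in_disk[OF t(2,3)]] r by (intro add_left_mono mult_right_mono)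
      also have "\<dots> = 2 * r * cmod (exp (L ?w))" using L(2)[OF in_disk[OF t(2,3)]] by simp
      also have "\<dots> \<le> 2 * r * (2 * cmod (exp (L (of_real s * z))) * ((1 - s * r) / (1 - t * r)) powr p)"
        using radial_growth[OF L(1) p(1) _ bd z s(1) t(1,3)] p r
        by (intro mult_left_mono) (auto simp: r_def)
      also have "\<dots> = A * r * (1 - t * r) powr (- p)"
        using xr[OF t(2,3)] xr[OF s] L(2)[OF in_disk[OF s]]
        by (simp add: A_def powr_divide powr_minus_divide)
      finally show "norm (deriv h ?w * z + cnj (deriv g ?w * z)) \<le> A * r * (1 - t * r) powr (- p)" .
    next
      show "continuous_on {a..b} (\<lambda>t. f (of_real t * z))"
        using ab s by (intro continuous_at_imp_continuous_on ballI has_vector_derivative_continuous[OF vec]) auto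
      have "1 - t * r \<noteq> 0" if "t \<in> {a..b}" for t using xr[of t] that ab s by auto
      then show "continuous_on {a..b} \<Phi>"
        unfolding \<Phi>_def using p by (intro continuous_intros) auto
    qed
    then show ?thesis by (simp add: dist_norm norm_minus_commute)
  qed simp
  have "curve_length (\<lambda>t. f (of_real t * z)) s 1 \<le> ereal (\<Phi> 1 - \<Phi> s)"
    by (rule curve_length_le[OF s(2) d])
  also have "\<Phi> 1 - \<Phi> s \<le> - \<Phi> s" using A0 p by (simp add: \<Phi>_def)
  also have "- \<Phi> s = 4 / (1 - p) * cmod (deriv h (of_real s * z)) * ((1 - s * r) powr p * (1 - s * r) powr (1 - p))"
    by (simp add: \<Phi>_def A_def)
  also have "(1 - s * r) powr p * (1 - s * r) powr (1 - p) = 1 - s * r"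
    using xr[OF s] by (simp add: powr_add[symmetric])
  finally show ?thesis by (simp add: r_def)
qed

section \<open>Distance to the boundary of the image\<close>

text \<open>On a disk around \<open>w\<close> whose radius is a small multiple of \<open>1 - \<bar>w\<bar>\<close>, the bound on \<open>L' = h''/h'\<close> makes \<open>h'\<close>
  nearly constant, so \<open>h\<close> is nearly affine there. The antiholomorphic part is dominated by the factor
  \<open>k < 1\<close>, hence \<open>f\<close> expands distances from \<open>w\<close> by at least a fixed multiple of \<open>\<bar>h' w\<bar>\<close>. As \<open>f\<close> is an open
  map, the image covers a disk of comparable radius. This takes the place of Koebe's quarter theorem.\<close>

lemma image_contains_ball:
  assumes f: "harmonic_decomp f h g" and inj: "inj_on f \<D>"
    and L: "L holomorphic_on \<D>" "\<And>w. w \<in> \<D> \<Longrightarrow> deriv h w = exp (L w)"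
    and bd: "\<And>w. w \<in> \<D> \<Longrightarrow> (1 - (cmod w)\<^sup>2) * cmod (deriv L w) \<le> 2"
    and k: "0 \<le> k" "k < 1" and dil: "\<And>w. w \<in> \<D> \<Longrightarrow> cmod (deriv g w) \<le> k * cmod (deriv h w)"
    and w: "w \<in> \<D>"
  shows "ball (f w) ((1 - k)\<^sup>2 / 64 * cmod (deriv h w) * (1 - cmod w)) \<subseteq> f ` \<D>"
proof -
  \<comment> \<open>The relative radius \<open>\<delta>\<close> makes \<open>h'\<close> vary by a fraction \<open>\<epsilon> = (1 - k) / 4\<close> only; then
    \<open>(1 - \<epsilon>) - k * (1 + \<epsilon>)\<close>, the expansion of \<open>h\<close> minus that of \<open>g\<close>, is at least \<open>(1 - k) / 2\<close>.\<close>
  define \<delta> where "\<delta> = (1 - k) / 32"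
  define d where "d = 1 - cmod w"
  define \<epsilon> where "\<epsilon> = 8 * \<delta>"
  define a where "a = cmod (deriv h w)"
  have \<delta>: "0 < \<delta>" "\<delta> \<le> 1/32" using k by (auto simp: \<delta>_def)
  have d: "0 < d" "d \<le> 1" using w by (auto simp: d_def)
  have a: "a > 0" using L(2)[OF w] by (simp add: a_def)
  let ?B = "cball w (\<delta> * d)"
  have near: "1 - cmod x \<ge> d / 2" if "x \<in> ?B" for x
  proof -
    have "cmod x \<le> cmod w + \<delta> * d" using that norm_triangle_sub[of x w] by (auto simp: dist_norm norm_minus_commute)
    moreover have "\<delta> * d \<le> (1/32) * d" using \<delta> d by (intro mult_right_mono) auto
    ultimately show ?thesis using d d_def by linarith
  qed
  have sub: "?B \<subseteq> \<D>"
  proof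
    fix x assume "x \<in> ?B"
    from near[OF this] d show "x \<in> \<D>" by simp
  qed
  have hol: "h holomorphic_on \<D>" "g holomorphic_on \<D>" using f by (auto simp: harmonic_decomp_def)
  have der: "(F has_field_derivative deriv F x) (at x within ?B)" if "F holomorphic_on \<D>" "x \<in> ?B" for F x
    by (rule holomorphic_derivI[where S=\<D>]) (use that sub in auto)
  have L': "cmod (deriv L x) \<le> 4 / d" if x: "x \<in> ?B" for x
  proof -
    have "(d / 2) * cmod (deriv L x) \<le> (1 - (cmod x)\<^sup>2) * cmod (deriv L x)"
    proof (rule mult_right_mono)
      have "cmod x < 1" using sub x by auto
      then have "(cmod x)\<^sup>2 \<le> cmod x" by (simp add: power2_eq_square mult_left_le_one_le)
      then show "d / 2 \<le> 1 - (cmod x)\<^sup>2" using near[OF x] by linarith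
    qed simp
    also have "\<dots> \<le> 2" using bd sub x by blast
    finally show ?thesis using d by (simp add: field_simps)
  qed
  have hx: "cmod (deriv h x - deriv h w) \<le> \<epsilon> * a" if x: "x \<in> ?B" for x
  proof -
    have "cmod (L x - L w) \<le> 4 / d * cmod (x - w)"
      by (rule field_differentiable_bound[OF convex_cball der[OF L(1)] L' x]) (use \<delta> d in auto)
    also have "\<dots> \<le> 4 / d * (\<delta> * d)"
      using x d by (intro mult_left_mono) (auto simp: dist_norm norm_minus_commute)
    also have "\<dots> = 4 * \<delta>" using d by simp
    finally have le: "cmod (L x - L w) \<le> 4 * \<delta>" .
    have "deriv h x = deriv h w * exp (L x - L w)"
      using L(2) sub x w by (auto simp: exp_diff)
    then have "cmod (deriv h x - deriv h w) = a * cmod (exp (L x - L w) - 1)"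
      unfolding a_def norm_mult[symmetric] by (simp add: right_diff_distrib)
    also have "\<dots> \<le> a * (2 * cmod (L x - L w))"
      using le \<delta> a by (intro mult_left_mono norm_exp_minus_1_le) auto
    also have "\<dots> \<le> a * (2 * (4 * \<delta>))" using le a by (intro mult_left_mono) auto
    finally show ?thesis by (simp add: \<epsilon>_def mult_ac)
  qed
  have lower: "(1 - k) / 2 * a * cmod (x - w) \<le> cmod (f x - f w)" if x: "x \<in> ?B" for x
  proof -
    have ww: "w \<in> ?B" using \<delta> d by simp
    have "cmod ((h x - deriv h w * x) - (h w - deriv h w * w)) \<le> \<epsilon> * a * cmod (x - w)"
    proof (rule field_differentiable_bound[OF convex_cball _ hx x ww])
      fix y assume "y \<in> ?B"
      from DERIV_diff[OF der[OF hol(1) this] DERIV_cmult[OF DERIV_ident, of "deriv h w"]]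
      show "((\<lambda>x. h x - deriv h w * x) has_field_derivative deriv h y - deriv h w) (at y within ?B)"
        by simp
    qed
    moreover have "cmod (deriv h w * (x - w)) = a * cmod (x - w)" by (simp add: a_def norm_mult)
    moreover have "deriv h w * (x - w) = (h x - h w) - ((h x - deriv h w * x) - (h w - deriv h w * w))"
      by (simp add: algebra_simps)
    ultimately have h: "cmod (h x - h w) \<ge> a * cmod (x - w) - \<epsilon> * a * cmod (x - w)"
      using norm_triangle_ineq4[of "h x - h w" "(h x - deriv h w * x) - (h w - deriv h w * w)"] by simp
    have g: "cmod (g x - g w) \<le> k * ((1 + \<epsilon>) * a) * cmod (x - w)"
    proof (rule field_differentiable_bound[OF convex_cball der[OF hol(2)] _ x ww])
      fix y assume y: "y \<in> ?B"
      have "cmod (deriv h y) \<le> a + \<epsilon> * a"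
        using hx[OF y] norm_triangle_sub[of "deriv h y" "deriv h w"] by (simp add: a_def)
      then have "k * cmod (deriv h y) \<le> k * (a + \<epsilon> * a)" using k by (intro mult_left_mono)
      then show "cmod (deriv g y) \<le> k * ((1 + \<epsilon>) * a)"
        using dil[of y] y sub by (fastforce simp: algebra_simps)
    qed
    have "f x - f w = (h x - h w) + cnj (g x - g w)"
      using f x sub w by (auto simp: harmonic_decomp_def)
    then have fhg: "cmod (f x - f w) \<ge> cmod (h x - h w) - cmod (g x - g w)"
      using norm_diff_ineq[of "h x - h w" "cnj (g x - g w)"] by (simp only: complex_mod_cnj)
    have "(1 - k) / 2 * a * cmod (x - w) \<le> (1 - \<epsilon> - k * (1 + \<epsilon>)) * (a * cmod (x - w))"
    proof -
      have "k * \<epsilon> \<le> \<epsilon>" using k \<delta> by (simp add: \<epsilon>_def mult_left_le_one_le)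
      moreover have "1 - k = 4 * \<epsilon>" by (simp add: \<epsilon>_def \<delta>_def)
      moreover have "1 - \<epsilon> - k * (1 + \<epsilon>) = (1 - k) - \<epsilon> - k * \<epsilon>" by (simp add: algebra_simps)
      ultimately have "(1 - k) / 2 \<le> 1 - \<epsilon> - k * (1 + \<epsilon>)" by simp
      then have "(1 - k) / 2 * (a * cmod (x - w)) \<le> (1 - \<epsilon> - k * (1 + \<epsilon>)) * (a * cmod (x - w))"
        using a by (intro mult_right_mono) auto
      then show ?thesis by (simp add: mult_ac)
    qed
    also have "\<dots> \<le> cmod (f x - f w)" using h g fhg by (simp add: algebra_simps)
    finally show ?thesis .
  qed
  have cont: "continuous_on \<D> f"
    by (meson f harmonic_has_derivative has_derivative_continuous continuous_at_imp_continuous_on)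
  have "ball (f w) ((1 - k) / 2 * a * (\<delta> * d)) \<subseteq> f ` ?B"
  proof (rule ball_subset_open_map_image)
    show "continuous_on (closure ?B) f" using continuous_on_subset[OF cont sub] by simp
    have "ball w (\<delta> * d) \<subseteq> \<D>" using sub ball_subset_cball by blast
    then show "open (f ` interior ?B)"
      using invariance_of_domain[of "ball w (\<delta> * d)" f] cont inj
      by (auto intro: continuous_on_subset inj_on_subset)
    show "(1 - k) / 2 * a * (\<delta> * d) \<le> cmod (f x - f w)" if "x \<in> frontier ?B" for x
    proof -
      have "cmod (x - w) = \<delta> * d" using that by (simp add: dist_norm norm_minus_commute)
      then show ?thesis using lower[of x] that by (simp add: dist_norm)
    qed
  qed (use \<delta> d a k in auto)
  also have "(1 - k) / 2 * a * (\<delta> * d) = (1 - k)\<^sup>2 / 64 * cmod (deriv h w) * (1 - cmod w)"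
    by (simp add: \<delta>_def d_def a_def power2_eq_square)
  finally show ?thesis using sub by blast
qed

text \<open>Boundedness of \<open>G\<close> guarantees a nonempty frontier; the distance to the empty set would be \<open>0\<close>.\<close>

lemma infdist_frontier_ge:
  fixes G :: "complex set"
  assumes "ball x m \<subseteq> G" "open G" "x \<in> G" "bounded G"
  shows "m \<le> infdist x (frontier G)"
proof -
  have "frontier G \<noteq> {}"
    using assms(3,4) frontier_not_empty[of G] not_bounded_UNIV by (metis empty_iff)
  then show ?thesis unfolding infdist_notempty[OF \<open>frontier G \<noteq> {}\<close>]
  proof (rule cINF_greatest)
    fix y assume "y \<in> frontier G"
    then have "y \<notin> G" using assms(2) by (simp add: frontier_def interior_open)
    then show "m \<le> dist x y" using assms(1) by (meson mem_ball not_le subsetD)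
  qed
qed

section \<open>A sufficient condition for radial John disks\<close>

text \<open>The quantity \<open>\<bar>h' w\<bar> (1 - \<bar>w\<bar>)\<close> bounds, up to constant factors, the length of the subarc beyond \<open>f w\<close> from
  above and the distance from \<open>f w\<close> to the boundary from below; the John constant is the quotient of the
  two factors. Working with a logarithm \<open>L\<close> of \<open>h'\<close> makes the hypothesis a bound on \<open>L'\<close>.\<close>

lemma radial_John_disk_if_pre_schwarzian_small:
  assumes f: "harmonic_decomp f h g" and inj: "inj_on f \<D>" and h0: "\<And>w. w \<in> \<D> \<Longrightarrow> deriv h w \<noteq> 0"
    and p: "0 \<le> p" "p < 1"
    and bd: "\<And>w. w \<in> \<D> \<Longrightarrow> (1 - (cmod w)\<^sup>2) * cmod (deriv (deriv h) w / deriv h w) \<le> 2 * p"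
    and k: "0 \<le> k" "k < 1" and dil: "\<And>w. w \<in> \<D> \<Longrightarrow> cmod (deriv g w) \<le> k * cmod (deriv h w)"
  shows "radial_John_disk f (f ` \<D>)"
proof -
  have hol: "h holomorphic_on \<D>" using f by (auto simp: harmonic_decomp_def)
  then have hol': "deriv h holomorphic_on \<D>" by (rule holomorphic_deriv) simp
  obtain L where L: "L holomorphic_on \<D>" "\<And>w. w \<in> \<D> \<Longrightarrow> deriv h w = exp (L w)"
    using contractible_imp_holomorphic_log[OF hol' convex_imp_contractible[OF convex_ball] h0] by blast
  have L': "deriv L w = deriv (deriv h) w / deriv h w" if w: "w \<in> \<D>" for w
  proof -
    have "((\<lambda>w. exp (L w)) has_field_derivative exp (L w) * deriv L w) (at w)"
      using L(1) w by (auto intro!: derivative_eq_intros holomorphic_derivI)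
    then have "(deriv h has_field_derivative exp (L w) * deriv L w) (at w)"
      by (rule has_field_derivative_transform_within_open[where S=\<D>]) (use w L(2) in auto)
    from DERIV_imp_deriv[OF this] show ?thesis using L(2)[OF w] by simp
  qed
  have bdL: "(1 - (cmod w)\<^sup>2) * cmod (deriv L w) \<le> 2 * p" if "w \<in> \<D>" for w
    using bd[OF that] L'[OF that] by simp
  have bdL2: "(1 - (cmod w)\<^sup>2) * cmod (deriv L w) \<le> 2" if "w \<in> \<D>" for w
    using bdL[OF that] p by simp
  have dil1: "cmod (deriv g w) \<le> cmod (deriv h w)" if "w \<in> \<D>" for w
    using dil[OF that] mult_left_le_one_le[of "cmod (deriv h w)" k] k by simp
  have cont: "continuous_on \<D> f"
    by (meson f harmonic_has_derivative has_derivative_continuous continuous_at_imp_continuous_on)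
  have arc: "curve_length (\<lambda>t. f (of_real t * z)) s 1 \<le>
      ereal (4 / (1 - p) * cmod (deriv h (of_real s * z)) * (1 - s * cmod z))"
    if "z \<in> \<D>" "0 \<le> s" "s \<le> 1" for z s
    by (rule radial_arc_bound[OF f L(1) _ p]) (assumption | rule L(2) bdL dil1 that)+
  have op: "open (f ` \<D>)" using invariance_of_domain[OF cont] inj by simp
  obtain k' where "homeomorphism \<D> (f ` \<D>) f k'"
    using invariance_of_domain_homeomorphism[OF _ cont _ inj] by auto
  then have "simply_connected (f ` \<D>)"
    using homeomorphic_simply_connected[of \<D> "f ` \<D>"] convex_imp_simply_connected[of \<D>]
    by (auto simp: homeomorphic_def)
  have bnd: "bounded (f ` \<D>)"
  proof -
    have "dist (f 0) (f z) \<le> 4 / (1 - p) * cmod (deriv h 0)" if z: "z \<in> \<D>" for z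
    proof -
      let ?t = "\<lambda>i::nat. real i"
      have "ereal (\<Sum>i<1. dist (f (of_real (?t i) * z)) (f (of_real (?t (Suc i)) * z)))
          \<le> curve_length (\<lambda>t. f (of_real t * z)) 0 1"
        unfolding curve_length_def
        by (rule SUP_upper2[of "(1, ?t)"]) (auto simp: mono_on_def)
      also have "\<dots> \<le> ereal (4 / (1 - p) * cmod (deriv h 0))" using arc[OF z, of 0] by simp
      finally show ?thesis by simp
    qed
    then show ?thesis unfolding bounded_def by blast
  qed
  define m where "m = (1 - k)\<^sup>2 / 64"
  have m: "m > 0" using k by (simp add: m_def)
  define c where "c = max 1 (4 / (1 - p) / m)"
  have John: "curve_length (\<lambda>t. f (of_real t * z)) s 1 \<le> ereal (c * infdist (f (of_real s * z)) (frontier (f ` \<D>)))"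
    if z: "z \<in> \<D>" and s: "0 \<le> s" "s \<le> 1" for z s
  proof -
    let ?w = "of_real s * z"
    have w: "?w \<in> \<D>" using z s mult_left_le_one_le[of "cmod z" s] by (auto simp: norm_mult)
    have dist: "m * cmod (deriv h ?w) * (1 - cmod ?w) \<le> infdist (f ?w) (frontier (f ` \<D>))"
      unfolding m_def
      by (rule infdist_frontier_ge[OF image_contains_ball[OF f inj L bdL2 k dil w] op _ bnd]) (use w in auto)
    have "4 / (1 - p) * cmod (deriv h ?w) * (1 - cmod ?w) = 4 / (1 - p) / m * (m * cmod (deriv h ?w) * (1 - cmod ?w))"
      using m by simp
    also have "\<dots> \<le> c * infdist (f ?w) (frontier (f ` \<D>))"
      using dist w m by (intro mult_mono) (auto simp: c_def)
    finally show ?thesis using arc[OF z s] s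
      by (auto simp: norm_mult intro: order_trans)
  qed
  have "radial_John_disk_const c f (f ` \<D>)"
    unfolding radial_John_disk_const_def
  proof (intro conjI ballI)
    show "1 \<le> c" by (simp add: c_def)
    fix z assume z: "z \<in> \<D>"
    show "curve_length (\<lambda>t. f (of_real t * z)) 0 1 < \<infinity>"
      using John[OF z, of 0] by (auto intro: le_less_trans)
    fix s :: real assume "s \<in> {0..1}"
    then show "curve_length (\<lambda>t. f (of_real t * z)) s 1 \<le> ereal (c * infdist (f (of_real s * z)) (frontier (f ` \<D>)))"
      using John[OF z] by auto
  qed (fact | simp)+
  then show ?thesis unfolding radial_John_disk_def by blast
qed

section \<open>Univalent holomorphic maps are quasiconformal\<close>

text \<open>The quotient \<open>Q w = (f w - f z)/(w - z)\<close> is holomorphic and zero-free with \<open>Q z = f' z\<close>. So the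
  logarithmic derivative \<open>f' w/(f w - f z)\<close> equals \<open>(f'/Q) w/(w - z)\<close>, and Cauchy's formula evaluates the
  winding number as \<open>(f'/Q) z = 1\<close>.\<close>

lemma winding_number_univalent_image:
  assumes f: "f holomorphic_on U" and U: "open U" and inj: "inj_on f U"
    and r: "0 < r" "cball z r \<subseteq> U"
  shows "winding_number (f \<circ> circlepath z r) (f z) = 1"
proof -
  have z: "z \<in> U" using r by auto
  have sph: "sphere z r \<subseteq> U" using r(2) by auto
  define Q where "Q = (\<lambda>w. if w = z then deriv f z else (f w - f z) / (w - z))"
  have Q: "Q holomorphic_on U" unfolding Q_def by (rule pole_lemma_open[OF f U])
  have f'z: "deriv f z \<noteq> 0" using holomorphic_injective_imp_regular[OF f U inj z] .
  have Q0: "Q w \<noteq> 0" if "w \<in> U" for w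
    using that f'z inj_onD[OF inj _ that z] by (auto simp: Q_def)
  have "(\<lambda>w. deriv f w / Q w) holomorphic_on cball z r"
    using r(2) Q0 by (intro holomorphic_on_subset[OF _ r(2)] holomorphic_on_divide holomorphic_deriv f Q U)
  from Cauchy_integral_circlepath_simple[OF this, of z] r(1)
  have cauchy: "((\<lambda>w. deriv f w / Q w / (w - z)) has_contour_integral 2 * of_real pi * \<i>) (circlepath z r)"
    using f'z by (simp add: Q_def)
  have avoid: "f w \<noteq> f z" if "w \<in> sphere z r" for w
    using that inj_onD[OF inj _ _ z, of w] sph r(1) by auto
  have "winding_number (f \<circ> circlepath z r) (f z) =
      1 / (of_real (2 * pi) * \<i>) * contour_integral (f \<circ> circlepath z r) (\<lambda>w. 1 / (w - f z))"
  proof (rule winding_number_valid_path)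
    show "valid_path (f \<circ> circlepath z r)"
      by (rule valid_path_compose_holomorphic[OF valid_path_circlepath f U]) (use sph r(1) in simp)
    show "f z \<notin> path_image (f \<circ> circlepath z r)"
      using avoid r(1) by (force simp: path_image_compose)
  qed
  also have "contour_integral (f \<circ> circlepath z r) (\<lambda>w. 1 / (w - f z)) =
      contour_integral (circlepath z r) (\<lambda>w. deriv f w * (1 / (f w - f z)))"
    by (rule contour_integral_comp_analyticW[where s=U]) (use f U sph r(1) in \<open>auto simp: analytic_on_open\<close>)
  also have "\<dots> = contour_integral (circlepath z r) (\<lambda>w. deriv f w / Q w / (w - z))"
  proof (rule contour_integral_eq)
    fix w assume "w \<in> path_image (circlepath z r)"
    then have "w \<noteq> z" using r(1) by auto
    then show "deriv f w * (1 / (f w - f z)) = deriv f w / Q w / (w - z)" by (simp add: Q_def)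
  qed
  also have "\<dots> = 2 * of_real pi * \<i>" using cauchy by (rule contour_integral_unique)
  finally show ?thesis by (simp add: o_def)
qed

lemma univalent_quasiconformal:
  assumes f: "f holomorphic_on U" and U: "open U" "connected U" "U \<noteq> {}" and inj: "inj_on f U" and K: "1 \<le> K"
  shows "quasiconformal_on K U f"
proof -
  have cont: "continuous_on U f" and cont': "continuous_on U (deriv f)"
    using f U(1) by (auto intro!: holomorphic_on_imp_continuous_on holomorphic_deriv)
  have der: "(f has_derivative (\<lambda>e. deriv f z * e)) (at z)" if "z \<in> U" for z
    using holomorphic_derivI[OF f U(1) that, of UNIV] unfolding has_field_derivative_def by simp
  have c: "continuous_on U (\<lambda>z. deriv f z * e)" for e
    by (intro continuous_on_mult cont' continuous_on_const)
  have weak: "weak_deriv U e f (\<lambda>z. deriv f z * e)" for e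
    by (rule weak_deriv_classical[OF U(1) der c])
  have "W12_loc U f (\<lambda>z. deriv f z * 1) (\<lambda>z. deriv f z * \<i>)"
    unfolding W12_loc_def by (intro conjI weak continuous_imp_loc_L2 cont c)
  moreover have "(cmod ((deriv f z * 1 - \<i> * (deriv f z * \<i>)) / 2) + cmod ((deriv f z * 1 + \<i> * (deriv f z * \<i>)) / 2))\<^sup>2
      \<le> K * \<bar>(cmod ((deriv f z * 1 - \<i> * (deriv f z * \<i>)) / 2))\<^sup>2 - (cmod ((deriv f z * 1 + \<i> * (deriv f z * \<i>)) / 2))\<^sup>2\<bar>" for z
  proof -
    have "(deriv f z * 1 - \<i> * (deriv f z * \<i>)) / 2 = deriv f z" "(deriv f z * 1 + \<i> * (deriv f z * \<i>)) / 2 = 0"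
      by (auto simp: complex_eq_iff)
    then show ?thesis using mult_right_mono[OF K, of "(cmod (deriv f z))\<^sup>2"]
      by (simp only: norm_zero) simp
  qed
  moreover obtain k where "homeomorphism U (f ` U) f k"
    using invariance_of_domain_homeomorphism[OF U(1) cont _ inj] by auto
  moreover have "sense_preserving_on U f"
    unfolding sense_preserving_on_def using winding_number_univalent_image[OF f U(1) inj] by blast
  ultimately show ?thesis
    unfolding quasiconformal_on_def Let_def using K U by blast
qed

section \<open>The extremal map and the theorem\<close>

text \<open>It maps the disk conformally onto an unbounded domain, and its derivative \<open>1/(1 - z)\<close> has the borderline
  growth, with exponent \<open>1\<close>, at which radial arcs stop being rectifiable up to the boundary.\<close>

definition log_map :: "complex \<Rightarrow> complex" where
  "log_map z = - Ln (1 - z)"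

lemma one_minus_not_nonpos_Reals:
  assumes "z \<in> \<D>" shows "1 - z \<notin> \<real>\<^sub>\<le>\<^sub>0"
proof
  assume "1 - z \<in> \<real>\<^sub>\<le>\<^sub>0"
  then have "Re (1 - z) \<le> 0" by (simp add: complex_nonpos_Reals_iff)
  with assms complex_Re_le_cmod[of z] show False by simp
qed

lemma one_minus_nonzero: "z \<in> \<D> \<Longrightarrow> 1 - z \<noteq> 0"
  by auto

lemma log_map_derivative:
  assumes "z \<in> \<D>" shows "(log_map has_field_derivative 1 / (1 - z)) (at z)"
  unfolding log_map_def
  by (rule derivative_eq_intros refl one_minus_not_nonpos_Reals[OF assms])+
     (simp add: divide_inverse)

lemma log_map_holomorphic: "log_map holomorphic_on \<D>"
  unfolding holomorphic_on_open[OF open_ball] using log_map_derivative by blast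

lemma deriv_log_map: "z \<in> \<D> \<Longrightarrow> deriv log_map z = 1 / (1 - z)"
  using log_map_derivative by (rule DERIV_imp_deriv)

lemma deriv_deriv_log_map:
  assumes "z \<in> \<D>" shows "deriv (deriv log_map) z = 1 / (1 - z)\<^sup>2"
proof -
  have "((\<lambda>z. 1 / (1 - z)) has_field_derivative 1 / (1 - z)\<^sup>2) (at z)"
    using one_minus_nonzero[OF assms] by (auto intro!: derivative_eq_intros simp: power2_eq_square)
  then have "(deriv log_map has_field_derivative 1 / (1 - z)\<^sup>2) (at z)"
    by (rule has_field_derivative_transform_within_open[where S=\<D>])
       (use assms in \<open>auto simp: deriv_log_map\<close>)
  then show ?thesis by (rule DERIV_imp_deriv)
qed

lemma inj_on_log_map: "inj_on log_map \<D>"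
proof (rule inj_onI)
  fix z w assume zw: "z \<in> \<D>" "w \<in> \<D>" "log_map z = log_map w"
  then have "exp (Ln (1 - z)) = exp (Ln (1 - w))" by (simp add: log_map_def)
  then show "z = w" using one_minus_nonzero[OF zw(1)] one_minus_nonzero[OF zw(2)] by simp
qed

lemma log_map_decomp: "harmonic_decomp log_map log_map (\<lambda>_. 0)"
  using log_map_holomorphic by (simp add: harmonic_decomp_def log_map_def)

lemma log_map_jacobian: "z \<in> \<D> \<Longrightarrow> jacobian log_map (\<lambda>_. 0) z > 0"
  using one_minus_nonzero[of z] by (simp add: jacobian_def deriv_log_map)

lemma log_map_in_S_H0_qc:
  assumes "1 \<le> K" shows "log_map \<in> S_H0_qc K (log_map ` \<D>)"
proof -
  have "quasiconformal_on K \<D> log_map"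
    by (rule univalent_quasiconformal[OF log_map_holomorphic _ _ _ inj_on_log_map assms]) auto
  moreover have "log_map \<in> S_H"
    unfolding S_H_def using inj_on_log_map log_map_decomp log_map_jacobian deriv_log_map[of 0]
    by (intro CollectI conjI exI[of _ log_map] exI[of _ "\<lambda>_. 0"]) auto
  moreover have "\<exists>h g. harmonic_decomp log_map h g \<and> deriv g 0 = 0"
    using log_map_decomp by (intro exI[of _ log_map] exI[of _ "\<lambda>_. 0"]) auto
  ultimately show ?thesis by (simp add: S_H0_qc_def S_H0_def)
qed

lemma log_map_image_unbounded: "\<not> bounded (log_map ` \<D>)"
proof
  assume "bounded (log_map ` \<D>)"
  then obtain B where B: "\<And>z. z \<in> \<D> \<Longrightarrow> cmod (log_map z) \<le> B"
    unfolding bounded_iff by blast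
  define x where "x = \<bar>B\<bar> + 1"
  have x: "x > 0" "x > B" by (auto simp: x_def)
  let ?z = "complex_of_real (1 - exp (- x))"
  have "cmod ?z < 1" unfolding norm_of_real using x by simp
  moreover have "log_map ?z = of_real x" 
    by (simp add: log_map_def exp_of_real[symmetric])
  ultimately show False using B[of ?z] x by simp
qed

text \<open>Here \<open>h''/h' = 1/(1 - z)\<close> and \<open>(1 - \<bar>z\<bar>\<^sup>2)/\<bar>1 - z\<bar> \<le> 1 + \<bar>z\<bar>\<close>, with equality on the positive radius; so \<open>2\<close> is the
  exact supremum and every larger threshold admits this map.\<close>

lemma log_map_pre_schwarzian_bound:
  assumes z: "z \<in> \<D>"
  shows "(1 - (cmod z)\<^sup>2) * cmod (deriv (deriv log_map) z / deriv log_map z) \<le> 2"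
proof -
  have q: "deriv (deriv log_map) z / deriv log_map z = 1 / (1 - z)"
    unfolding deriv_log_map[OF z] deriv_deriv_log_map[OF z]
    using one_minus_nonzero[OF z] by (simp add: power2_eq_square)
  have r: "0 \<le> cmod z" "cmod z < 1" using z by auto
  have le: "1 - cmod z \<le> cmod (1 - z)" using norm_triangle_ineq2[of 1 z] by simp
  have "(1 - (cmod z)\<^sup>2) = (1 - cmod z) * (1 + cmod z)" by (simp add: power2_eq_square algebra_simps)
  also have "\<dots> \<le> cmod (1 - z) * 2" using le r by (intro mult_mono) auto
  finally have "1 - (cmod z)\<^sup>2 \<le> 2 * cmod (1 - z)" by simp
  moreover have "cmod (1 - z) > 0" using le r by linarith
  ultimately have "(1 - (cmod z)\<^sup>2) / cmod (1 - z) \<le> 2" by (simp only: pos_divide_le_eq)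
  then show ?thesis by (simp add: q norm_divide)
qed

text \<open>The strict inequality leaves room for an exponent \<open>p < 1\<close>, and \<open>K\<close>-quasiconformality bounds the dilatation
  by \<open>(K - 1)/(K + 1) < 1\<close>.\<close>

lemma S_H0_qc_radial_John:
  assumes fS: "f \<in> S_H0_qc K \<Omega>" and f: "harmonic_decomp f h g"
    and sup: "(SUP z\<in>\<D>. ereal ((1 - (cmod z)\<^sup>2) *
               cmod (pre_schwarzian h g z +
                     deriv (dilatation h g) z * cnj (dilatation h g z) /
                     of_real (1 - (cmod (dilatation h g z))\<^sup>2)))) < 2"
  shows "radial_John_disk f \<Omega>"
proof -
  have inj: "inj_on f \<D>" and qc: "quasiconformal_on K \<D> f" and \<Omega>: "f ` \<D> = \<Omega>"
    using fS by (auto simp: S_H0_qc_def S_H0_def S_H_def)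
  obtain h\<^sub>1 g\<^sub>1 where 1: "harmonic_decomp f h\<^sub>1 g\<^sub>1" "\<And>z. z \<in> \<D> \<Longrightarrow> jacobian h\<^sub>1 g\<^sub>1 z > 0"
    using fS by (auto simp: S_H0_qc_def S_H0_def S_H_def)
  have jac: "jacobian h g z > 0" if "z \<in> \<D>" for z
    using 1(2)[OF that] harmonic_decomp_deriv_unique[OF f 1(1) that] by (simp add: jacobian_def)
  have hol: "h holomorphic_on \<D>" "g holomorphic_on \<D>" using f by (auto simp: harmonic_decomp_def)
  obtain c where c: "(SUP z\<in>\<D>. ereal ((1 - (cmod z)\<^sup>2) *
               cmod (pre_schwarzian h g z +
                     deriv (dilatation h g) z * cnj (dilatation h g z) /
                     of_real (1 - (cmod (dilatation h g z))\<^sup>2)))) < ereal c" "ereal c < 2"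
    using ereal_dense2[OF sup] by blast
  define p where "p = max 0 (c / 2)"
  have p: "0 \<le> p" "p < 1" using c(2) by (auto simp: p_def)
  have bd: "(1 - (cmod w)\<^sup>2) * cmod (deriv (deriv h) w / deriv h w) \<le> 2 * p" if w: "w \<in> \<D>" for w
  proof -
    have "ereal ((1 - (cmod w)\<^sup>2) * cmod (deriv (deriv h) w / deriv h w)) \<le> ereal c"
      unfolding pre_schwarzian_plus_dilatation[OF hol w jac[OF w], symmetric]
      by (rule order_trans[OF SUP_upper[OF w] less_imp_le[OF c(1)]])
    then show ?thesis by (simp add: p_def)
  qed
  have K: "1 \<le> K" using qc by (simp add: quasiconformal_on_def)
  have dil: "cmod (deriv g w) \<le> (K - 1) / (K + 1) * cmod (deriv h w)" if "w \<in> \<D>" for w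
    using quasiconformal_harmonic_dilatation[OF qc f jac that] K by (simp add: field_simps)
  have "deriv h w \<noteq> 0" if "w \<in> \<D>" for w
    using jac[OF that] by (auto simp: jacobian_def)
  from radial_John_disk_if_pre_schwarzian_small[OF f inj this p bd _ _ dil] K \<Omega>
  show ?thesis by simp
qed

text \<open>For sharpness the same map serves for every \<open>K\<close>, being conformal with \<open>g = 0\<close>.\<close>

theorem corollary1p6:
  fixes K :: real
  assumes "K \<ge> 1"
  shows "(\<forall>f h g \<Omega>. f \<in> S_H0_qc K \<Omega> \<and> harmonic_decomp f h g \<and> inj_on h \<D> \<and>
            (SUP z\<in>\<D>. ereal ((1 - (cmod z)\<^sup>2) *
               cmod (pre_schwarzian h g z +
                     deriv (dilatation h g) z * cnj (dilatation h g z) /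
                     of_real (1 - (cmod (dilatation h g z))\<^sup>2)))) < 2
            \<longrightarrow> radial_John_disk f \<Omega>) \<and>
         (\<forall>C::real. C > 2 \<longrightarrow>
         \<not> (\<forall>f h g \<Omega>. f \<in> S_H0_qc K \<Omega> \<and> harmonic_decomp f h g \<and> inj_on h \<D> \<and>
              (SUP z\<in>\<D>. ereal ((1 - (cmod z)\<^sup>2) *
                 cmod (pre_schwarzian h g z +
                       deriv (dilatation h g) z * cnj (dilatation h g z) /
                       of_real (1 - (cmod (dilatation h g z))\<^sup>2)))) < ereal C
              \<longrightarrow> radial_John_disk f \<Omega>))"
proof (intro conjI allI impI notI)
  fix f h g \<Omega>
  assume "f \<in> S_H0_qc K \<Omega> \<and> harmonic_decomp f h g \<and> inj_on h \<D> \<and>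
            (SUP z\<in>\<D>. ereal ((1 - (cmod z)\<^sup>2) *
               cmod (pre_schwarzian h g z +
                     deriv (dilatation h g) z * cnj (dilatation h g z) /
                     of_real (1 - (cmod (dilatation h g z))\<^sup>2)))) < 2"
  then show "radial_John_disk f \<Omega>" using S_H0_qc_radial_John by blast
next
  fix C :: real
  assume C: "C > 2" and all: "\<forall>f h g \<Omega>. f \<in> S_H0_qc K \<Omega> \<and> harmonic_decomp f h g \<and> inj_on h \<D> \<and>
              (SUP z\<in>\<D>. ereal ((1 - (cmod z)\<^sup>2) *
                 cmod (pre_schwarzian h g z +
                       deriv (dilatation h g) z * cnj (dilatation h g z) /
                       of_real (1 - (cmod (dilatation h g z))\<^sup>2)))) < ereal C
              \<longrightarrow> radial_John_disk f \<Omega>"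
  have "(SUP z\<in>\<D>. ereal ((1 - (cmod z)\<^sup>2) *
          cmod (pre_schwarzian log_map (\<lambda>_. 0) z +
                deriv (dilatation log_map (\<lambda>_. 0)) z * cnj (dilatation log_map (\<lambda>_. 0) z) /
                of_real (1 - (cmod (dilatation log_map (\<lambda>_. 0) z))\<^sup>2)))) \<le> ereal 2"
  proof (rule SUP_least)
    fix z assume z: "z \<in> \<D>"
    show "ereal ((1 - (cmod z)\<^sup>2) *
          cmod (pre_schwarzian log_map (\<lambda>_. 0) z +
                deriv (dilatation log_map (\<lambda>_. 0)) z * cnj (dilatation log_map (\<lambda>_. 0) z) /
                of_real (1 - (cmod (dilatation log_map (\<lambda>_. 0) z))\<^sup>2))) \<le> ereal 2"
      unfolding pre_schwarzian_plus_dilatation[OF log_map_holomorphic holomorphic_on_const z log_map_jacobian[OF z]]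
      using log_map_pre_schwarzian_bound[OF z] by simp
  qed
  also have "ereal 2 < ereal C" using C by simp
  finally have "radial_John_disk log_map (log_map ` \<D>)"
    using all log_map_in_S_H0_qc[OF assms] log_map_decomp inj_on_log_map by blast
  then show False
    using log_map_image_unbounded by (auto simp: radial_John_disk_def radial_John_disk_const_def)
qed

end
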